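(* Let $c>0$ and let $H=\{x\in\mathbb{H}^{n+1}\mid x_{n+1}=c\}$ be a horosphere in the hyperbolic space $\mathbb{H}^{n+1}$. Let $(M,g)$ be a complete connected Riemannian manifold and let $f:M\to\mathbb{H}^{n+1}$ be a proper harmonic map with $f(M)\subseteq\{x\in\mathbb{H}^{n+1}\mid x_{n+1}>c\}$, the region above $H$. Then $f$ is constant.
   Context: $\mathbb{H}^{n+1}=\{x\in\mathbb{R}^{n+1}\mid x_{n+1}>0\}$ is the upper halfspace model with metric $ds^2=\tfrac{1}{x_{n+1}^2}(dx_1^2+\dots+dx_{n+1}^2)$ of constant sectional curvature $-1$. Harmonic map: a smooth map whose tension field $\mathrm{tr}_g\nabla df$ vanishes. Proper: preimages of compact sets (here, compact subsets of $\mathbb{H}^{n+1}$) are compact. *)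

theory Defs
  imports "HOL-Analysis.Analysis"
begin

fun Ck_on :: "nat \<Rightarrow> 'a::real_normed_vector set \<Rightarrow> ('a \<Rightarrow> 'b::real_normed_vector) \<Rightarrow> bool" where
  "Ck_on 0 S F \<longleftrightarrow> continuous_on S F"
| "Ck_on (Suc k) S F \<longleftrightarrow>
     (\<forall>x\<in>S. F differentiable (at x)) \<and>
     (\<forall>v. Ck_on k S (\<lambda>x. frechet_derivative F (at x) v))"

(* Only used for open S, where differentiability at x and within S coincide. *)
definition smooth_on :: "'a::real_normed_vector set \<Rightarrow> ('a \<Rightarrow> 'b::real_normed_vector) \<Rightarrow> bool" where
  "smooth_on S F \<longleftrightarrow> (\<forall>k. Ck_on k S F)"

definition partial_deriv :: "'m::finite \<Rightarrow> (real^'m \<Rightarrow> real) \<Rightarrow> real^'m \<Rightarrow> real" where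
  "partial_deriv i F x = frechet_derivative F (at x) (axis i 1)"


text \<open>Smooth manifolds without boundary, of dimension \<open>CARD('m)\<close>. A chart is a pair of its
  domain \<open>U\<close> and a map \<open>\<phi>\<close>, of which only the values on \<open>U\<close> matter.\<close>

type_synonym ('a, 'm) chart = "'a set \<times> ('a \<Rightarrow> real^'m)"

definition is_chart :: "'a topology \<Rightarrow> ('a, 'm::finite) chart \<Rightarrow> bool" where
  "is_chart M = (\<lambda>(U, \<phi>). openin M U \<and> open (\<phi> ` U) \<and>
     homeomorphic_map (subtopology M U) (top_of_set (\<phi> ` U)) \<phi>)"

definition transition :: "('a, 'm::finite) chart \<Rightarrow> ('a, 'm) chart \<Rightarrow> real^'m \<Rightarrow> real^'m" where
  "transition = (\<lambda>(U, \<phi>) (V, \<psi>). \<psi> \<circ> inv_into U \<phi>)"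

definition smooth_manifold :: "'a topology \<Rightarrow> ('a, 'm::finite) chart set \<Rightarrow> bool" where
  "smooth_manifold M A \<longleftrightarrow>
     Hausdorff_space M \<and> second_countable M \<and>
     (\<forall>C\<in>A. is_chart M C) \<and> (\<Union>C\<in>A. fst C) = topspace M \<and>
     (\<forall>(U, \<phi>)\<in>A. \<forall>(V, \<psi>)\<in>A. smooth_on (\<phi> ` (U \<inter> V)) (transition (U, \<phi>) (V, \<psi>)))"


text \<open>A Riemannian metric is a covariant 2-tensor field, given by its matrix of components in each
  chart (as a function on the image of the chart) subject to the tensor transformation law.\<close>

type_synonym ('a, 'm) metric_components = "('a, 'm) chart \<Rightarrow> real^'m \<Rightarrow> real^'m^'m"

definition riemannian_metric_on :: "(real^'m::finite) set \<Rightarrow> (real^'m \<Rightarrow> real^'m^'m) \<Rightarrow> bool" where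
  "riemannian_metric_on S G \<longleftrightarrow> smooth_on S G \<and>
     (\<forall>x\<in>S. transpose (G x) = G x \<and> (\<forall>v. v \<noteq> 0 \<longrightarrow> 0 < v \<bullet> (G x *v v)))"

definition riemannian_manifold ::
  "'a topology \<Rightarrow> ('a, 'm::finite) chart set \<Rightarrow> ('a, 'm) metric_components \<Rightarrow> bool" where
  "riemannian_manifold M A g \<longleftrightarrow>
     smooth_manifold M A \<and>
     (\<forall>(U, \<phi>)\<in>A. riemannian_metric_on (\<phi> ` U) (g (U, \<phi>))) \<and>
     (\<forall>(U, \<phi>)\<in>A. \<forall>(V, \<psi>)\<in>A. \<forall>p\<in>U \<inter> V.
        let J = matrix (frechet_derivative (transition (U, \<phi>) (V, \<psi>)) (at (\<phi> p)))
        in g (U, \<phi>) (\<phi> p) = transpose J ** g (V, \<psi>) (\<psi> p) ** J)"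

text \<open>\<open>christoffel G k i j\<close> is the symbol \<open>\<Gamma>\<close> with upper index \<open>k\<close> and lower indices \<open>i\<close>, \<open>j\<close>
  of the Levi-Civita connection of \<open>G\<close>.\<close>

definition christoffel ::
  "(real^'m::finite \<Rightarrow> real^'m^'m) \<Rightarrow> 'm \<Rightarrow> 'm \<Rightarrow> 'm \<Rightarrow> real^'m \<Rightarrow> real" where
  "christoffel G k i j x = (1/2) * (\<Sum>l\<in>UNIV. matrix_inv (G x) $ k $ l *
     (partial_deriv i (\<lambda>y. G y $ j $ l) x + partial_deriv j (\<lambda>y. G y $ i $ l) x
        - partial_deriv l (\<lambda>y. G y $ i $ j) x))"


text \<open>Completeness is geodesic completeness: every initial point and velocity is that of a
  geodesic defined on all of \<open>\<real>\<close>.\<close>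

definition geodesic ::
  "'a topology \<Rightarrow> ('a, 'm::finite) chart set \<Rightarrow> ('a, 'm) metric_components \<Rightarrow> (real \<Rightarrow> 'a) \<Rightarrow> bool" where
  "geodesic M A g \<gamma> \<longleftrightarrow> continuous_map euclideanreal M \<gamma> \<and>
     (\<forall>(U, \<phi>)\<in>A. smooth_on {t. \<gamma> t \<in> U} (\<phi> \<circ> \<gamma>) \<and>
        (\<forall>t k. \<gamma> t \<in> U \<longrightarrow>
           (let u' = (\<lambda>s. vector_derivative (\<phi> \<circ> \<gamma>) (at s)) in
            vector_derivative u' (at t) $ k +
              (\<Sum>i\<in>UNIV. \<Sum>j\<in>UNIV.
                 christoffel (g (U, \<phi>)) k i j (\<phi> (\<gamma> t)) * (u' t $ i) * (u' t $ j)) = 0)))"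

definition complete_riemannian_manifold ::
  "'a topology \<Rightarrow> ('a, 'm::finite) chart set \<Rightarrow> ('a, 'm) metric_components \<Rightarrow> bool" where
  "complete_riemannian_manifold M A g \<longleftrightarrow>
     riemannian_manifold M A g \<and>
     (\<forall>(U, \<phi>)\<in>A. \<forall>p\<in>U. \<forall>v. \<exists>\<gamma>. geodesic M A g \<gamma> \<and> \<gamma> 0 = p \<and>
        vector_derivative (\<phi> \<circ> \<gamma>) (at 0) = v)"


text \<open>\<open>second_fundamental_form G h F i j \<alpha> x\<close> is the component with index \<open>\<alpha>\<close> of
  \<open>\<nabla>dF\<close> applied to the coordinate fields \<open>\<partial>\<^sub>i\<close>, \<open>\<partial>\<^sub>j\<close>, where \<open>\<nabla>\<close> is induced by the
  Levi-Civita connections of the domain metric \<open>G\<close> and the target metric \<open>h\<close>;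
  \<open>tension_field G h F x\<close> is its trace with respect to \<open>G\<close>.\<close>

definition second_fundamental_form ::
  "(real^'m::finite \<Rightarrow> real^'m^'m) \<Rightarrow> (real^'n::finite \<Rightarrow> real^'n^'n) \<Rightarrow> (real^'m \<Rightarrow> real^'n)
     \<Rightarrow> 'm \<Rightarrow> 'm \<Rightarrow> 'n \<Rightarrow> real^'m \<Rightarrow> real" where
  "second_fundamental_form G h F i j \<alpha> x =
     partial_deriv i (partial_deriv j (\<lambda>y. F y $ \<alpha>)) x
     - (\<Sum>k\<in>UNIV. christoffel G k i j x * partial_deriv k (\<lambda>y. F y $ \<alpha>) x)
     + (\<Sum>\<beta>\<in>UNIV. \<Sum>\<gamma>\<in>UNIV. christoffel h \<alpha> \<beta> \<gamma> (F x) *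
          partial_deriv i (\<lambda>y. F y $ \<beta>) x * partial_deriv j (\<lambda>y. F y $ \<gamma>) x)"

definition tension_field ::
  "(real^'m::finite \<Rightarrow> real^'m^'m) \<Rightarrow> (real^'n::finite \<Rightarrow> real^'n^'n) \<Rightarrow> (real^'m \<Rightarrow> real^'n)
     \<Rightarrow> real^'m \<Rightarrow> real^'n" where
  "tension_field G h F x = (\<chi> \<alpha>. \<Sum>i\<in>UNIV. \<Sum>j\<in>UNIV.
     matrix_inv (G x) $ i $ j * second_fundamental_form G h F i j \<alpha> x)"

text \<open>Harmonic maps into an open subset \<open>N\<close> of Euclidean space with Riemannian metric \<open>h\<close>.\<close>

definition harmonic_map ::
  "'a topology \<Rightarrow> ('a, 'm::finite) chart set \<Rightarrow> ('a, 'm) metric_components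
     \<Rightarrow> (real^'n::finite) set \<Rightarrow> (real^'n \<Rightarrow> real^'n^'n) \<Rightarrow> ('a \<Rightarrow> real^'n) \<Rightarrow> bool" where
  "harmonic_map M A g N h f \<longleftrightarrow>
     f ` topspace M \<subseteq> N \<and>
     (\<forall>(U, \<phi>)\<in>A. smooth_on (\<phi> ` U) (f \<circ> inv_into U \<phi>) \<and>
        (\<forall>p\<in>U. tension_field (g (U, \<phi>)) h (f \<circ> inv_into U \<phi>) (\<phi> p) = 0))"

definition proper_into :: "'a topology \<Rightarrow> 'b::topological_space set \<Rightarrow> ('a \<Rightarrow> 'b) \<Rightarrow> bool" where
  "proper_into M N f \<longleftrightarrow>
     (\<forall>K. K \<subseteq> N \<and> compact K \<longrightarrow> compactin M {p \<in> topspace M. f p \<in> K})"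


text \<open>Upper half-space model of hyperbolic space of dimension \<open>CARD('n)\<close>. The order on the index
  type serves only to single out the last coordinate.\<close>

definition last_coord :: "real^'n::{finite,linorder} \<Rightarrow> real" where
  "last_coord x = x $ Max UNIV"

definition hyperbolic_space :: "(real^'n::{finite,linorder}) set" where
  "hyperbolic_space = {x. 0 < last_coord x}"

definition hyperbolic_metric ::
  "real^'n::{finite,linorder} \<Rightarrow> real^'n::{finite,linorder}^'n::{finite,linorder}" where
  "hyperbolic_metric x = (1 / (last_coord x)\<^sup>2) *\<^sub>R mat 1"

end

theory Submission
  imports Defs
begin

text \<open>On the upper half-space with metric \<open>h\<close>, the functions
  \<open>w(y) = (1 - \<epsilon> \<bar>y\<bar>\<^sup>2) / y\<^sub>n\<^sub>+\<^sub>1\<close> (restrictions of linear functions on Minkowski space) satisfy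
  \<open>Hess w = w h\<close>, so \<open>w \<circ> f\<close> is subharmonic wherever it is positive. For \<open>a > 0\<close> the part of
  \<open>{w \<ge> a}\<close> above the horosphere is compact; hence, once \<open>\<epsilon>\<close> is so small that \<open>w \<circ> f\<close> is
  positive somewhere, properness of \<open>f\<close> provides a point where \<open>w \<circ> f\<close> attains its maximum
  \<open>A > 0\<close>. By the strong maximum principle \<open>w \<circ> f\<close> is constant near such a point, which forces
  \<open>df = 0\<close> there, so that the set where \<open>f\<close> takes its value at the maximum is open and closed.

  Quotients are avoided by working with \<open>\<psi> = 1 - \<epsilon> \<bar>f\<bar>\<^sup>2 - A u \<le> 0\<close>, where \<open>u\<close> is the last
  coordinate of \<open>f\<close>: it satisfies \<open>\<Delta>\<psi> - 2 \<langle>\<nabla>u, \<nabla>\<psi>\<rangle> / u = A \<bar>df\<bar>\<^sup>2 / u\<close> with the Euclidean norm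
  of \<open>df\<close>.\<close>

section \<open>Partial derivatives and their calculus rules\<close>

lemma has_derivative_partial_deriv:
  fixes h :: "real^'m::finite \<Rightarrow> real"
  assumes "h differentiable (at x)"
  shows "(h has_derivative (\<lambda>v. \<Sum>i\<in>UNIV. v $ i * partial_deriv i h x)) (at x)"
proof -
  let ?D = "frechet_derivative h (at x)"
  have D: "(h has_derivative ?D) (at x)"
    using assms by (simp add: frechet_derivative_works)
  then have lin: "linear ?D"
    by (rule has_derivative_linear)
  have "?D v = (\<Sum>i\<in>UNIV. v $ i * partial_deriv i h x)" for v
  proof -
    have "?D v = ?D (\<Sum>i\<in>UNIV. v $ i *\<^sub>R axis i 1)"
      by (metis basis_expansion scalar_mult_eq_scaleR)
    also have "\<dots> = (\<Sum>i\<in>UNIV. v $ i * ?D (axis i 1))"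
      by (simp add: linear_sum[OF lin] linear_cmul[OF lin])
    finally show ?thesis
      by (simp add: partial_deriv_def)
  qed
  then show ?thesis
    using D by presburger
qed

lemma partial_deriv_eq:
  assumes "(h has_derivative D) (at x)"
  shows "partial_deriv i h x = D (axis i 1)"
  using frechet_derivative_at[OF assms] by (simp add: partial_deriv_def)

lemma partial_deriv_cong:
  assumes "open S" "x \<in> S" "\<And>y. y \<in> S \<Longrightarrow> f y = g y"
  shows "partial_deriv i f x = partial_deriv i g x"
proof -
  have "(f has_derivative D) (at x) \<longleftrightarrow> (g has_derivative D) (at x)" for D
    using has_derivative_transform_within_open[of f D x UNIV S g]
      has_derivative_transform_within_open[of g D x UNIV S f] assms by auto
  then show ?thesis
    by (simp add: partial_deriv_def frechet_derivative_def)
qed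

lemma differentiable_cong_open:
  assumes "f differentiable (at x)" "open S" "x \<in> S" "\<And>y. y \<in> S \<Longrightarrow> f y = g y"
  shows "g differentiable (at x)"
  using assms has_derivative_transform_within_open unfolding differentiable_def by blast

lemma partial_deriv_const [simp]: "partial_deriv i (\<lambda>x. c) x = 0"
  by (subst partial_deriv_eq[OF has_derivative_const]) simp

lemma partial_deriv_component: "partial_deriv i (\<lambda>x. x $ k) x = (if i = k then 1 else 0)"
  by (subst partial_deriv_eq[OF bounded_linear_imp_has_derivative[OF bounded_linear_vec_nth]])
    (auto simp: axis_def)

lemma
  assumes "f differentiable (at x)" "g differentiable (at x)"
  shows partial_deriv_add:
      "partial_deriv i (\<lambda>x. f x + g x) x = partial_deriv i f x + partial_deriv i g x"
    and partial_deriv_mult: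
      "partial_deriv i (\<lambda>x. f x * g x) x = f x * partial_deriv i g x + g x * partial_deriv i f x"
proof -
  have f: "(f has_derivative frechet_derivative f (at x)) (at x)"
    and g: "(g has_derivative frechet_derivative g (at x)) (at x)"
    using assms by (simp_all add: frechet_derivative_works)
  show "partial_deriv i (\<lambda>x. f x + g x) x = partial_deriv i f x + partial_deriv i g x"
    by (subst partial_deriv_eq[OF has_derivative_add[OF f g]]) (simp add: partial_deriv_def)
  show "partial_deriv i (\<lambda>x. f x * g x) x = f x * partial_deriv i g x + g x * partial_deriv i f x"
    by (subst partial_deriv_eq[OF has_derivative_mult[OF f g]])
      (simp add: partial_deriv_def algebra_simps)
qed

lemma partial_deriv_sum:
  assumes "finite I" "\<And>k. k \<in> I \<Longrightarrow> f k differentiable (at x)"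
  shows "partial_deriv i (\<lambda>x. \<Sum>k\<in>I. f k x) x = (\<Sum>k\<in>I. partial_deriv i (f k) x)"
  using assms
proof (induction I)
  case (insert k I)
  then show ?case
    by (simp add: partial_deriv_add differentiable_sum)
qed simp

subsection \<open>Second order operators and the strong maximum principle\<close>

text \<open>A pointwise form of second-order regularity: it passes to sums and products through the
  rules for \<open>differentiable\<close>, and it suffices for the second derivative test. Mixed
  partials may differ a priori; their order is absorbed by symmetric coefficients.\<close>

definition twice_differentiable_on :: "(real^'m::finite) set \<Rightarrow> (real^'m \<Rightarrow> real) \<Rightarrow> bool" where
  "twice_differentiable_on S h \<longleftrightarrow>
     (\<forall>x\<in>S. h differentiable (at x) \<and> (\<forall>i. partial_deriv i h differentiable (at x)))"

lemma twice_differentiable_onD: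
  assumes "twice_differentiable_on S h" "x \<in> S"
  shows "h differentiable (at x)" "partial_deriv i h differentiable (at x)"
  using assms by (auto simp: twice_differentiable_on_def)

lemma twice_differentiable_on_const: "twice_differentiable_on S (\<lambda>x. c)"
proof -
  have "partial_deriv i (\<lambda>x::real^'a. c) = (\<lambda>x. 0)" for i
    by auto
  then show ?thesis
    by (simp add: twice_differentiable_on_def)
qed

lemma twice_differentiable_on_component: "twice_differentiable_on S (\<lambda>x. x $ k)"
proof -
  have "partial_deriv i (\<lambda>x::real^'a. x $ k) = (\<lambda>x. if i = k then 1 else 0)" for i
    by (auto simp: partial_deriv_component)
  moreover have "(\<lambda>x::real^'a. x $ k) differentiable (at x)" for x
    by (rule bounded_linear_imp_differentiable[OF bounded_linear_vec_nth])
  ultimately show ?thesis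
    by (simp add: twice_differentiable_on_def)
qed

lemma
  assumes S: "open S" and f: "twice_differentiable_on S f" and g: "twice_differentiable_on S g"
  shows twice_differentiable_on_add: "twice_differentiable_on S (\<lambda>x. f x + g x)"
    and twice_differentiable_on_mult: "twice_differentiable_on S (\<lambda>x. f x * g x)"
proof -
  note d = twice_differentiable_onD[OF f] twice_differentiable_onD[OF g]
  have "partial_deriv i (\<lambda>x. f x + g x) differentiable (at x)" if x: "x \<in> S" for i x
    by (rule differentiable_cong_open[OF differentiable_add[OF d(2)[OF x, of i] d(4)[OF x, of i]] S x])
      (simp add: partial_deriv_add d)
  then show "twice_differentiable_on S (\<lambda>x. f x + g x)"
    by (simp add: twice_differentiable_on_def d)
  have "partial_deriv i (\<lambda>x. f x * g x) differentiable (at x)" if x: "x \<in> S" for i x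
    by (rule differentiable_cong_open[OF differentiable_add[OF
            differentiable_mult[OF d(1)[OF x] d(4)[OF x, of i]]
            differentiable_mult[OF d(3)[OF x] d(2)[OF x, of i]]] S x])
      (simp add: partial_deriv_mult d)
  then show "twice_differentiable_on S (\<lambda>x. f x * g x)"
    by (simp add: twice_differentiable_on_def d)
qed

lemma twice_differentiable_on_sum:
  assumes "open S" "finite I" "\<And>k. k \<in> I \<Longrightarrow> twice_differentiable_on S (f k)"
  shows "twice_differentiable_on S (\<lambda>x. \<Sum>k\<in>I. f k x)"
  using assms(2,3)
  by (induction I) (simp_all add: twice_differentiable_on_const twice_differentiable_on_add assms(1))

text \<open>The coefficients are frozen numbers; a variable operator appears as
  \<open>elliptic_op (a x) (b x) h x\<close>. The minus sign before the drift matches the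
  Laplace-Beltrami operator, whose first-order part is minus the trace of the Christoffel
  symbols.\<close>

definition elliptic_op ::
  "('m::finite \<Rightarrow> 'm \<Rightarrow> real) \<Rightarrow> ('m \<Rightarrow> real) \<Rightarrow> (real^'m \<Rightarrow> real) \<Rightarrow> real^'m \<Rightarrow> real" where
  "elliptic_op a b h x =
     (\<Sum>i\<in>UNIV. \<Sum>j\<in>UNIV. a i j * partial_deriv i (partial_deriv j h) x)
     - (\<Sum>k\<in>UNIV. b k * partial_deriv k h x)"

lemma elliptic_op_const: "elliptic_op a b (\<lambda>x. c) x = 0"
proof -
  have "partial_deriv i (\<lambda>x::real^'a. c) = (\<lambda>x. 0)" for i
    by auto
  then show ?thesis
    by (simp add: elliptic_op_def)
qed

lemma elliptic_op_component: "elliptic_op a b (\<lambda>x. x $ k) x = - b k"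
proof -
  have "partial_deriv i (\<lambda>x::real^'a. x $ k) = (\<lambda>x. if i = k then 1 else 0)" for i
    by (auto simp: partial_deriv_component)
  then show ?thesis
    by (simp add: elliptic_op_def if_distrib cong: if_cong)
qed

lemma elliptic_op_cong:
  assumes S: "open S" "x \<in> S" and eq: "\<And>y. y \<in> S \<Longrightarrow> f y = g y"
  shows "elliptic_op a b f x = elliptic_op a b g x"
proof -
  have 1: "partial_deriv i f y = partial_deriv i g y" if "y \<in> S" for i y
    by (rule partial_deriv_cong[OF S(1) that eq])
  then have "partial_deriv i (partial_deriv j f) x = partial_deriv i (partial_deriv j g) x" for i j
    by (intro partial_deriv_cong[OF S])
  then show ?thesis
    by (simp add: elliptic_op_def 1 S)
qed

text \<open>In the product rule the drift acts as a derivation, while the second-order part leaves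
  two mixed first-order sums. These agree after exchanging \<open>i\<close> and \<open>j\<close>,
  since \<open>a\<close> is symmetric, which gives the factor 2.\<close>

lemma
  assumes S: "open S" "x \<in> S"
    and f: "twice_differentiable_on S f" and g: "twice_differentiable_on S g"
  shows elliptic_op_add:
      "elliptic_op a b (\<lambda>x. f x + g x) x = elliptic_op a b f x + elliptic_op a b g x"
    and elliptic_op_mult: "(\<And>i j. a i j = a j i) \<Longrightarrow>
      elliptic_op a b (\<lambda>x. f x * g x) x = f x * elliptic_op a b g x + g x * elliptic_op a b f x
        + 2 * (\<Sum>i\<in>UNIV. \<Sum>j\<in>UNIV. a i j * partial_deriv i f x * partial_deriv j g x)"
proof -
  note d = twice_differentiable_onD[OF f] twice_differentiable_onD[OF g]
  have "partial_deriv i (partial_deriv j (\<lambda>x. f x + g x)) x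
      = partial_deriv i (\<lambda>x. partial_deriv j f x + partial_deriv j g x) x" for i j
    by (rule partial_deriv_cong[OF S]) (simp add: partial_deriv_add d)
  then show "elliptic_op a b (\<lambda>x. f x + g x) x = elliptic_op a b f x + elliptic_op a b g x"
    by (simp add: elliptic_op_def partial_deriv_add d S sum.distrib algebra_simps)
  assume sym: "\<And>i j. a i j = a j i"
  have "partial_deriv i (partial_deriv j (\<lambda>x. f x * g x)) x
      = partial_deriv i (\<lambda>x. f x * partial_deriv j g x + g x * partial_deriv j f x) x" for i j
    by (rule partial_deriv_cong[OF S]) (simp add: partial_deriv_mult d)
  then have eq: "partial_deriv i (partial_deriv j (\<lambda>x. f x * g x)) x
      = f x * partial_deriv i (partial_deriv j g) x + g x * partial_deriv i (partial_deriv j f) x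
        + partial_deriv i f x * partial_deriv j g x + partial_deriv j f x * partial_deriv i g x" for i j
    by (simp add: partial_deriv_add partial_deriv_mult differentiable_mult d S)
  have swap: "(\<Sum>i\<in>UNIV. \<Sum>j\<in>UNIV. a i j * partial_deriv j f x * partial_deriv i g x)
      = (\<Sum>i\<in>UNIV. \<Sum>j\<in>UNIV. a i j * partial_deriv i f x * partial_deriv j g x)"
    by (subst sum.swap) (simp add: sym)
  show "elliptic_op a b (\<lambda>x. f x * g x) x = f x * elliptic_op a b g x + g x * elliptic_op a b f x
        + 2 * (\<Sum>i\<in>UNIV. \<Sum>j\<in>UNIV. a i j * partial_deriv i f x * partial_deriv j g x)"
    using swap
    by (simp add: elliptic_op_def partial_deriv_mult d S eq sum.distrib sum_distrib_left
        algebra_simps)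
qed

lemma elliptic_op_cmult:
  assumes "open S" "x \<in> S" "twice_differentiable_on S f"
  shows "elliptic_op a b (\<lambda>x. c * f x) x = c * elliptic_op a b f x"
proof -
  note d = twice_differentiable_onD[OF assms(3)]
  have "partial_deriv i (partial_deriv j (\<lambda>x. c * f x)) x
      = partial_deriv i (\<lambda>x. c * partial_deriv j f x) x" for i j
    by (rule partial_deriv_cong[OF assms(1,2)]) (simp add: partial_deriv_mult d)
  then show ?thesis
    by (simp add: elliptic_op_def partial_deriv_mult d assms sum_distrib_left algebra_simps)
qed

lemma elliptic_op_sum:
  assumes "open S" "x \<in> S" "finite I" "\<And>k. k \<in> I \<Longrightarrow> twice_differentiable_on S (f k)"
  shows "elliptic_op a b (\<lambda>x. \<Sum>k\<in>I. f k x) x = (\<Sum>k\<in>I. elliptic_op a b (f k) x)"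
  using assms(3,4)
proof (induction I)
  case (insert k I)
  then show ?case
    by (simp add: elliptic_op_add[OF assms(1,2)] twice_differentiable_on_sum assms(1))
qed (simp add: elliptic_op_const)

text \<open>By induction on \<open>I\<close>, splitting off one square at a time from the form \<open>P\<close>.\<close>

lemma sum_mult_nonpos_if_semidefinite:
  fixes P H :: "'i \<Rightarrow> 'i \<Rightarrow> real"
  assumes "finite I" "\<And>i j. P i j = P j i"
    and "\<And>v. 0 \<le> (\<Sum>i\<in>I. \<Sum>j\<in>I. P i j * v i * v j)"
    and "\<And>v. (\<Sum>i\<in>I. \<Sum>j\<in>I. H i j * v i * v j) \<le> 0"
  shows "(\<Sum>i\<in>I. \<Sum>j\<in>I. P i j * H i j) \<le> 0"
  using assms
proof (induction I arbitrary: P)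
  case (insert s I)
  have H_I: "(\<Sum>i\<in>I. \<Sum>j\<in>I. H i j * v i * v j) \<le> 0" for v
  proof -
    have "(\<Sum>i\<in>insert s I. \<Sum>j\<in>insert s I. H i j * (v(s := 0)) i * (v(s := 0)) j)
        = (\<Sum>i\<in>I. \<Sum>j\<in>I. H i j * v i * v j)"
      using insert.hyps by (auto intro!: sum.cong)
    then show ?thesis
      using insert.prems(3)[of "v(s := 0)"] by simp
  qed
  \<comment> \<open>The form is read as a quadratic polynomial in the single entry
    \<open>v s\<close>.\<close>
  have quad: "(\<Sum>i\<in>insert s I. \<Sum>j\<in>insert s I. P i j * v i * v j)
      = P s s * (v s)\<^sup>2 + 2 * v s * (\<Sum>i\<in>I. P i s * v i)
        + (\<Sum>i\<in>I. \<Sum>j\<in>I. P i j * v i * v j)" for v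
  proof -
    have "(\<Sum>j\<in>I. P s j * v s * v j) = (\<Sum>i\<in>I. P i s * v i * v s)"
      by (intro sum.cong refl) (simp add: insert.prems(1)[of s] mult.commute mult.left_commute)
    then show ?thesis
      using insert.hyps
      by (simp add: sum.distrib sum_distrib_left power2_eq_square algebra_simps)
  qed
  \<comment> \<open>Overwriting the entry of \<open>v\<close> at \<open>s\<close> makes
    \<open>t\<close> independent of the other entries.\<close>
  have pos: "0 \<le> P s s * t\<^sup>2 + 2 * t * (\<Sum>i\<in>I. P i s * v i)
        + (\<Sum>i\<in>I. \<Sum>j\<in>I. P i j * v i * v j)" for t v
  proof -
    have "(\<Sum>i\<in>I. P i s * (v(s := t)) i) = (\<Sum>i\<in>I. P i s * v i)"
      "(\<Sum>i\<in>I. \<Sum>j\<in>I. P i j * (v(s := t)) i * (v(s := t)) j) = (\<Sum>i\<in>I. \<Sum>j\<in>I. P i j * v i * v j)"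
      using insert.hyps by (auto intro!: sum.cong)
    then show ?thesis
      using insert.prems(2)[of "v(s := t)"] unfolding quad by simp
  qed
  have diag: "0 \<le> P s s"
    using pos[of 1 "\<lambda>_. 0"] by simp
  show ?case
  proof (cases "P s s = 0")
    case True
    \<comment> \<open>With a vanishing diagonal entry the polynomial is affine in \<open>t\<close>,
      and it can stay nonnegative only if its slope vanishes.\<close>
    have zero: "P i s = 0" if "i \<in> I" for i
    proof (rule ccontr)
      assume ne: "P i s \<noteq> 0"
      have eq: "(\<Sum>k\<in>I. P k s * (if k = i then 1 else 0)) = P i s"
        "(\<Sum>k\<in>I. \<Sum>j\<in>I. P k j * (if k = i then 1 else 0) * (if j = i then 1 else 0)) = P i i"
      proof -
        have "(\<Sum>j\<in>I. X j * (if j = i then 1 else 0)) = X i" for X :: "'i \<Rightarrow> real"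
          using sum.remove[OF insert.hyps(1) that, of "\<lambda>j. X j * (if j = i then 1 else 0)"] by simp
        then show "(\<Sum>k\<in>I. P k s * (if k = i then 1 else 0)) = P i s"
          "(\<Sum>k\<in>I. \<Sum>j\<in>I. P k j * (if k = i then 1 else 0) * (if j = i then 1 else 0)) = P i i"
          by simp_all
      qed
      have "0 \<le> 2 * t * P i s + P i i" for t
        using pos[of t "\<lambda>k. if k = i then 1 else 0"] unfolding eq True by simp
      \<comment> \<open>At this \<open>t\<close> the affine expression equals -1.\<close>
      from this[of "- (P i i + 1) / (2 * P i s)"] show False
        using ne by (simp add: field_simps)
    qed
    have "P s j = 0" if "j \<in> I" for j
      using zero[OF that] insert.prems(1) by metis
    then have "(\<Sum>i\<in>insert s I. \<Sum>j\<in>insert s I. P i j * H i j) = (\<Sum>i\<in>I. \<Sum>j\<in>I. P i j * H i j)"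
      using insert.hyps True zero by simp
    also have "\<dots> \<le> 0"
    proof (rule insert.IH[OF insert.prems(1) _ H_I])
      show "0 \<le> (\<Sum>i\<in>I. \<Sum>j\<in>I. P i j * v i * v j)" for v
        using pos[of 0 v] by simp
    qed
    finally show ?thesis .
  next
    case False
    then have d: "0 < P s s"
      using diag by simp
    \<comment> \<open>The Schur complement of the entry \<open>P s s\<close>: what remains of the
      form after completing the square in \<open>v s\<close>.\<close>
    define Q where "Q i j = P i j - P i s * P j s / P s s" for i j
    have "(\<Sum>i\<in>I. \<Sum>j\<in>I. Q i j * H i j) \<le> 0"
    proof (rule insert.IH[OF _ _ H_I])
      show "Q i j = Q j i" for i j
        by (simp add: Q_def insert.prems(1)[of i j])
      fix v
      let ?p = "\<Sum>i\<in>I. P i s * v i"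
      have "(\<Sum>i\<in>I. \<Sum>j\<in>I. Q i j * v i * v j)
          = (\<Sum>i\<in>I. \<Sum>j\<in>I. P i j * v i * v j) - ?p * ?p / P s s"
        by (simp add: Q_def sum_subtractf sum_product sum_divide_distrib algebra_simps)
      \<comment> \<open>This \<open>t\<close> is the minimizer of the quadratic polynomial, and the
        minimum is exactly the form of \<open>Q\<close>.\<close>
      also have "0 \<le> \<dots>"
        using pos[of "- ?p / P s s" v] d by (simp add: power2_eq_square field_simps)
      finally show "0 \<le> (\<Sum>i\<in>I. \<Sum>j\<in>I. Q i j * v i * v j)" .
    qed
    moreover have "(\<Sum>i\<in>insert s I. \<Sum>j\<in>insert s I. Q i j * H i j) = (\<Sum>i\<in>I. \<Sum>j\<in>I. Q i j * H i j)"
    proof -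
      have "Q i s = 0" "Q s i = 0" for i
        using d insert.prems(1)[of s i] by (simp_all add: Q_def)
      then show ?thesis
        using insert.hyps by simp
    qed
    \<comment> \<open>\<open>P\<close> is \<open>Q\<close> plus a rank-one matrix built from its
      column \<open>s\<close>. Contracting the latter with \<open>H\<close> evaluates the form of
      \<open>H\<close> at that column, which is nonpositive.\<close>
    moreover have "(\<Sum>i\<in>insert s I. \<Sum>j\<in>insert s I. P i j * H i j)
        = (\<Sum>i\<in>insert s I. \<Sum>j\<in>insert s I. Q i j * H i j)
          + (\<Sum>i\<in>insert s I. \<Sum>j\<in>insert s I. H i j * P i s * P j s) / P s s"
      unfolding sum_divide_distrib sum.distrib[symmetric]
      by (intro sum.cong refl) (simp add: Q_def algebra_simps)
    moreover have "(\<Sum>i\<in>insert s I. \<Sum>j\<in>insert s I. H i j * P i s * P j s) / P s s \<le> 0"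
      using insert.prems(3)[of "\<lambda>i. P i s"] d by (simp add: divide_nonpos_pos)
    ultimately show ?thesis
      by linarith
  qed
qed simp

section \<open>First- and second-order conditions at an interior maximum\<close>

lemma partial_deriv_eq_0_at_max:
  assumes S: "open S" "x \<in> S" and h: "h differentiable (at x)"
    and max: "\<And>y. y \<in> S \<Longrightarrow> h y \<le> h x"
  shows "partial_deriv i h x = 0"
proof -
  have "(h has_derivative frechet_derivative h (at x)) (at x)"
    using h by (simp add: frechet_derivative_works)
  moreover have "frechet_derivative h (at x) = (\<lambda>v. 0)"
    by (rule differential_zero_maxmin[of x S h]) (use assms calculation in auto)
  ultimately show ?thesis
    by (simp add: partial_deriv_def)
qed

text \<open>Along the line through \<open>x\<close> in direction \<open>v\<close>, a positive second
  derivative and a zero first derivative would make the function strictly increase just after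
  \<open>x\<close>.\<close>

lemma hessian_nonpos_at_max:
  fixes h :: "real^'m::finite \<Rightarrow> real"
  assumes S: "open S" "x \<in> S" and h: "twice_differentiable_on S h"
    and max: "\<And>y. y \<in> S \<Longrightarrow> h y \<le> h x"
  shows "(\<Sum>i\<in>UNIV. \<Sum>j\<in>UNIV. partial_deriv i (partial_deriv j h) x * v $ i * v $ j) \<le> 0"
    (is "?H \<le> 0")
proof (rule ccontr)
  assume "\<not> ?H \<le> 0"
  then have H: "0 < ?H"
    by simp
  obtain e where e: "0 < e" "ball x e \<subseteq> S"
    using S open_contains_ball by blast
  define g' where "g' t = (\<Sum>j\<in>UNIV. v $ j * partial_deriv j h (x + t *\<^sub>R v))" for t
  have line: "((\<lambda>t. x + t *\<^sub>R v) has_derivative (\<lambda>t. t *\<^sub>R v)) (at t)" for t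
    by (auto intro!: derivative_eq_intros)
  have g: "((\<lambda>t. h (x + t *\<^sub>R v)) has_real_derivative g' t) (at t)" if "x + t *\<^sub>R v \<in> S" for t
  proof -
    have "((\<lambda>t. h (x + t *\<^sub>R v)) has_derivative
        (\<lambda>s. \<Sum>i\<in>UNIV. (s *\<^sub>R v) $ i * partial_deriv i h (x + t *\<^sub>R v))) (at t)"
      using has_derivative_compose[OF line has_derivative_partial_deriv]
        twice_differentiable_onD(1)[OF h that] by blast
    moreover have "(\<lambda>s. \<Sum>i\<in>UNIV. (s *\<^sub>R v) $ i * partial_deriv i h (x + t *\<^sub>R v)) = (*) (g' t)"
      by (auto simp: g'_def sum_distrib_right fun_eq_iff intro!: sum.cong)
    ultimately show ?thesis
      by (simp add: has_field_derivative_def)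
  qed
  have "(g' has_real_derivative ?H) (at 0)"
  proof -
    have "((\<lambda>t. partial_deriv j h (x + t *\<^sub>R v)) has_derivative
        (\<lambda>s. \<Sum>i\<in>UNIV. (s *\<^sub>R v) $ i * partial_deriv i (partial_deriv j h) x)) (at 0)" for j
      using has_derivative_compose[OF line[of 0] , of "partial_deriv j h"]
        has_derivative_partial_deriv twice_differentiable_onD(2)[OF h S(2), of j] by fastforce
    moreover have "(\<lambda>s. \<Sum>i\<in>UNIV. (s *\<^sub>R v) $ i * partial_deriv i (partial_deriv j h) x)
        = (*) (\<Sum>i\<in>UNIV. v $ i * partial_deriv i (partial_deriv j h) x)" for j
      by (auto simp: sum_distrib_right fun_eq_iff intro!: sum.cong)
    ultimately have "((\<lambda>t. partial_deriv j h (x + t *\<^sub>R v)) has_real_derivative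
        (\<Sum>i\<in>UNIV. v $ i * partial_deriv i (partial_deriv j h) x)) (at 0)" for j
      by (simp add: has_field_derivative_def)
    then have "(g' has_real_derivative
        (\<Sum>j\<in>UNIV. v $ j * (\<Sum>i\<in>UNIV. v $ i * partial_deriv i (partial_deriv j h) x))) (at 0)"
      unfolding g'_def by (auto intro!: derivative_eq_intros sum.cong)
    moreover have "(\<Sum>j\<in>UNIV. v $ j * (\<Sum>i\<in>UNIV. v $ i * partial_deriv i (partial_deriv j h) x)) = ?H"
      by (subst sum.swap) (simp add: sum_distrib_left algebra_simps)
    ultimately show ?thesis
      by simp
  qed
  \<comment> \<open>The derivative of \<open>g'\<close> at 0 is positive, so \<open>g'\<close>
    exceeds its value 0 at the maximum for small positive \<open>t\<close>.\<close>
  from DERIV_pos_inc_right[OF this H] obtain d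
    where d: "0 < d" "\<And>t. 0 < t \<Longrightarrow> t < d \<Longrightarrow> g' 0 < g' t"
    by (metis add_0)
  have "g' 0 = 0"
    using partial_deriv_eq_0_at_max[OF S twice_differentiable_onD(1)[OF h S(2)] max]
    by (simp add: g'_def)
  \<comment> \<open>The first bound keeps \<open>g'\<close> positive up to \<open>T\<close>, the
    second keeps the segment in the ball of radius \<open>e\<close>; adding 1 to the norm covers
    \<open>v = 0\<close>.\<close>
  define T where "T = min (d / 2) (e / (2 * (norm v + 1)))"
  have "0 < T"
    using d(1) e(1) by (simp add: T_def add_nonneg_pos)
  have in_S: "x + t *\<^sub>R v \<in> S" if "0 \<le> t" "t \<le> T" for t
  proof -
    have "t * norm v \<le> T * (norm v + 1)"
      using that by (intro mult_mono) auto
    also have "\<dots> \<le> e / (2 * (norm v + 1)) * (norm v + 1)"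
      by (intro mult_right_mono) (auto simp: T_def)
    also have "\<dots> = e / 2"
      using norm_ge_zero[of v] by (auto simp: add_nonneg_eq_0_iff divide_simps)
    also have "\<dots> < e"
      using e(1) by simp
    finally show ?thesis
      using e(2) that by (auto simp: dist_norm)
  qed
  have "h (x + 0 *\<^sub>R v) < h (x + T *\<^sub>R v)"
  proof (rule DERIV_pos_imp_increasing_open[OF \<open>0 < T\<close>])
    fix t assume t: "0 < t" "t < T"
    then have "0 < g' t"
      using d(2)[of t] \<open>g' 0 = 0\<close> d(1) by (simp add: T_def)
    then show "\<exists>y. ((\<lambda>t. h (x + t *\<^sub>R v)) has_real_derivative y) (at t) \<and> 0 < y"
      using g in_S t by (meson less_imp_le)
  next
    show "continuous_on {0..T} (\<lambda>t. h (x + t *\<^sub>R v))"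
      by (rule DERIV_continuous_on[where D = g']) (auto intro!: has_field_derivative_at_within g in_S)
  qed
  then show False
    using max[OF in_S[of T]] \<open>0 < T\<close> by simp
qed

text \<open>The gradient vanishes at a maximum, so the drift drops out. The rest contracts a
  positive semidefinite matrix with a negative semidefinite Hessian form.\<close>

lemma elliptic_op_nonpos_at_max:
  fixes h :: "real^'m::finite \<Rightarrow> real"
  assumes S: "open S" "x \<in> S" and h: "twice_differentiable_on S h"
    and max: "\<And>y. y \<in> S \<Longrightarrow> h y \<le> h x"
    and sym: "\<And>i j. a i j = a j i"
    and pos: "\<And>v::real^'m. 0 \<le> (\<Sum>i\<in>UNIV. \<Sum>j\<in>UNIV. a i j * v $ i * v $ j)"
  shows "elliptic_op a b h x \<le> 0"
proof -
  have "(\<Sum>i\<in>UNIV. \<Sum>j\<in>UNIV. a i j * partial_deriv i (partial_deriv j h) x) \<le> 0"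
  proof (rule sum_mult_nonpos_if_semidefinite[OF finite sym])
    fix v :: "'m \<Rightarrow> real"
    show "0 \<le> (\<Sum>i\<in>UNIV. \<Sum>j\<in>UNIV. a i j * v i * v j)"
      using pos[of "\<chi> i. v i"] by simp
    show "(\<Sum>i\<in>UNIV. \<Sum>j\<in>UNIV. partial_deriv i (partial_deriv j h) x * v i * v j) \<le> 0"
      using hessian_nonpos_at_max[OF S h max, of "\<chi> i. v i"] by simp
  qed
  then show ?thesis
    using partial_deriv_eq_0_at_max[OF S twice_differentiable_onD(1)[OF h S(2)] max]
    by (simp add: elliptic_op_def)
qed

text \<open>Hopf's barrier at a point \<open>p\<close> of the sphere of radius \<open>r\<close> around \<open>z\<close>. Any polynomial
  \<open>-s + K s\<^sup>2\<close> in \<open>s = \<bar>x - z\<bar>\<^sup>2 - r\<^sup>2\<close> with \<open>K\<close> large will do.\<close>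

lemma hopf_barrier:
  fixes z p :: "real^'m::finite" and a :: "real^'m \<Rightarrow> 'm \<Rightarrow> 'm \<Rightarrow> real"
  assumes S: "open S" "p \<in> S" and "p \<noteq> z"
    and a: "\<And>i j. continuous_on S (\<lambda>x. a x i j)" and b: "\<And>k. continuous_on S (\<lambda>x. b x k)"
    and sym: "\<And>x i j. x \<in> S \<Longrightarrow> a x i j = a x j i"
    and pos: "\<And>v. v \<noteq> 0 \<Longrightarrow> 0 < (\<Sum>i\<in>UNIV. \<Sum>j\<in>UNIV. a p i j * v $ i * v $ j)"
  obtains e v where "0 < e" "ball p e \<subseteq> S" "twice_differentiable_on S v" "continuous_on UNIV v"
    "v p = 0"
    "\<And>x. x \<in> ball p e \<Longrightarrow> dist z p < dist z x \<Longrightarrow> v x < 0"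
    "\<And>x. x \<in> ball p e \<Longrightarrow> 0 < elliptic_op (a x) (b x) v x"
proof -
  \<comment> \<open>With these constants \<open>s\<close> is assembled from coordinates by sums and
    products, so the calculus rules above apply to it directly.\<close>
  define c where "c k = - z $ k" for k
  define d where "d = - (dist z p)\<^sup>2"
  define s where "s x = (\<Sum>k\<in>UNIV. (x $ k + c k) * (x $ k + c k)) + d" for x
  have s_eq: "s x = (dist z x)\<^sup>2 - (dist z p)\<^sup>2" for x
    by (simp add: s_def c_def d_def dist_norm norm_minus_commute power2_norm_eq_inner inner_vec_def)
  define Ls where
    "Ls x = (\<Sum>k\<in>UNIV. 2 * ((x $ k + c k) * - b x k + a x k k))" for x
  define As where "As x = (\<Sum>i\<in>UNIV. \<Sum>j\<in>UNIV. a x i j * (x - z) $ i * (x - z) $ j)" for x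
  have diff1: "twice_differentiable_on S (\<lambda>x. x $ k + c k)" for k
    by (intro twice_differentiable_on_add S twice_differentiable_on_component twice_differentiable_on_const)
  have diff2: "twice_differentiable_on S (\<lambda>x. (x $ k + c k) * (x $ k + c k))" for k
    by (intro twice_differentiable_on_mult S diff1)
  have diff3: "twice_differentiable_on S (\<lambda>x. \<Sum>k\<in>UNIV. (x $ k + c k) * (x $ k + c k))"
    by (intro twice_differentiable_on_sum S diff2) simp
  have diff: "twice_differentiable_on S s"
    unfolding s_def by (intro twice_differentiable_on_add S diff3 twice_differentiable_on_const)
  have pd1: "partial_deriv i (\<lambda>x. x $ k + c k) x = (if i = k then 1 else 0)" if "x \<in> S" for i k x
    using twice_differentiable_onD(1)[OF twice_differentiable_on_component that]
    by (simp add: partial_deriv_add partial_deriv_component)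
  have pd: "partial_deriv i s x = 2 * (x - z) $ i" if x: "x \<in> S" for i x
  proof -
    note D = twice_differentiable_onD(1)[OF _ x]
    have "partial_deriv i s x
        = (\<Sum>k\<in>UNIV. partial_deriv i (\<lambda>x. (x $ k + c k) * (x $ k + c k)) x)"
      unfolding s_def
      by (simp add: partial_deriv_add[OF D[OF diff3] D[OF twice_differentiable_on_const]]
          partial_deriv_sum D[OF diff2])
    also have "\<dots> = (\<Sum>k\<in>UNIV. if i = k then 2 * (x $ k + c k) else 0)"
      by (intro sum.cong refl, subst partial_deriv_mult[OF D[OF diff1] D[OF diff1]])
        (simp add: pd1[OF x])
    finally show ?thesis
      by (simp add: c_def)
  qed
  have Ls: "elliptic_op (a x) (b x) s x = Ls x" if x: "x \<in> S" for x
  proof -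
    note const = elliptic_op_const twice_differentiable_on_const
    have "elliptic_op (a x) (b x) (\<lambda>x. x $ k + c k) x = - b x k" for k
      by (subst elliptic_op_add[OF S(1) x twice_differentiable_on_component const(2)])
        (simp add: const elliptic_op_component)
    moreover have "(\<Sum>i\<in>UNIV. \<Sum>j\<in>UNIV. a x i j * (if i = k then 1 else 0) * (if j = k then 1 else 0))
        = a x k k" for k
    proof -
      have delta: "(\<Sum>j\<in>UNIV. c j * (if j = k then 1 else 0)) = c k" for c :: "'m \<Rightarrow> real"
        using sum.remove[of UNIV k "\<lambda>j. c j * (if j = k then 1 else 0)"] by simp
      show ?thesis
        by (simp add: delta flip: sum_distrib_right)
    qed
    ultimately have "elliptic_op (a x) (b x) (\<lambda>x. (x $ k + c k) * (x $ k + c k)) x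
        = 2 * ((x $ k + c k) * - b x k + a x k k)" for k
      by (subst elliptic_op_mult[OF S(1) x diff1 diff1 sym[OF x]])
        (simp add: pd1[OF x] ring_distribs)
    then show ?thesis
      unfolding s_def Ls_def
      by (simp add: elliptic_op_add[OF S(1) x diff3 const(2)] const(1)
          elliptic_op_sum[OF S(1) x _ diff2])
  qed
  \<comment> \<open>Chosen so that \<open>K * As p\<close> exceeds the absolute value of
    \<open>Ls p\<close>: where \<open>s\<close> vanishes, the operator applied to \<open>v\<close>
    is \<open>- Ls p + 8 * K * As p\<close>, hence positive.\<close>
  define K where "K = (\<bar>Ls p\<bar> + 1) / As p"
  define v where "v x = (- 1) * s x + K * (s x * s x)" for x
  have "0 < As p"
    using pos[of "p - z"] \<open>p \<noteq> z\<close> by (simp add: As_def)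
  then have "0 < K"
    by (simp add: K_def add_nonneg_pos)
  have diff_ss: "twice_differentiable_on S (\<lambda>x. s x * s x)"
    by (intro twice_differentiable_on_mult S diff)
  have diff_parts: "twice_differentiable_on S (\<lambda>x. (- 1) * s x)"
    "twice_differentiable_on S (\<lambda>x. K * (s x * s x))"
    by (intro twice_differentiable_on_mult S diff twice_differentiable_on_const)+
  have diff_v: "twice_differentiable_on S v"
    unfolding v_def by (intro twice_differentiable_on_add S diff_parts)
  define Lv where "Lv x = - Ls x + K * (2 * s x * Ls x + 8 * As x)" for x
  have Lv: "elliptic_op (a x) (b x) v x = Lv x" if x: "x \<in> S" for x
  proof -
    have "(\<Sum>i\<in>UNIV. \<Sum>j\<in>UNIV. a x i j * partial_deriv i s x * partial_deriv j s x) = 4 * As x"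
      by (simp add: pd[OF x] As_def sum_distrib_left algebra_simps)
    then have "elliptic_op (a x) (b x) (\<lambda>x. s x * s x) x = 2 * s x * Ls x + 8 * As x"
      by (simp add: elliptic_op_mult[OF S(1) x diff diff sym[OF x]] Ls[OF x])
    then show ?thesis
      unfolding v_def Lv_def
      by (simp only: elliptic_op_add[OF S(1) x diff_parts] elliptic_op_cmult[OF S(1) x diff_ss]
          elliptic_op_cmult[OF S(1) x diff] Ls[OF x])
  qed
  have cont_s: "continuous_on T s" for T
    unfolding s_def by (intro continuous_intros)
  have "continuous_on S Lv"
    unfolding Lv_def Ls_def As_def by (intro continuous_intros cont_s a b)
  then have "isCont Lv p"
    using S by (simp add: continuous_on_eq_continuous_at)
  moreover have "0 < Lv p"
  proof -
    have "s p = 0"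
      by (simp add: s_eq)
    moreover have "K * As p = \<bar>Ls p\<bar> + 1"
      using \<open>0 < As p\<close> by (simp add: K_def)
    ultimately show ?thesis
      by (simp add: Lv_def)
  qed
  ultimately have "eventually (\<lambda>x. 0 < Lv x) (nhds p)"
    by (simp add: continuous_at_imp_continuous_at_within order_tendstoD(1) isCont_def
        tendsto_at_iff_tendsto_nhds)
  \<comment> \<open>For \<open>0 < s < 1 / K\<close> the linear term of
    \<open>- s + K * s * s\<close> dominates, so the barrier is negative outside the sphere.\<close>
  moreover have "eventually (\<lambda>x. s x < 1 / K) (nhds p)"
  proof -
    have "(s \<longlongrightarrow> s p) (nhds p)"
      using cont_s[of UNIV] by (simp add: continuous_on_eq_continuous_at isCont_def
          tendsto_at_iff_tendsto_nhds)
    then show ?thesis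
      by (rule order_tendstoD(2)) (use \<open>0 < K\<close> in \<open>simp add: s_eq\<close>)
  qed
  moreover have "eventually (\<lambda>x. x \<in> S) (nhds p)"
    using S by (rule eventually_nhds_in_open)
  ultimately have "eventually (\<lambda>x. x \<in> S \<and> 0 < Lv x \<and> s x < 1 / K) (nhds p)"
    by eventually_elim simp
  then obtain e where e: "0 < e" "\<And>x. dist x p < e \<Longrightarrow> x \<in> S \<and> 0 < Lv x \<and> s x < 1 / K"
    by (auto simp: eventually_nhds_metric)
  show thesis
  proof
    show "0 < e" "ball p e \<subseteq> S" "twice_differentiable_on S v"
      using e diff_v by (auto simp: dist_commute)
    show "continuous_on UNIV v"
      unfolding v_def by (intro continuous_intros cont_s)
    show "v p = 0"
      by (simp add: v_def s_eq)
    show "v x < 0" if "x \<in> ball p e" "dist z p < dist z x" for x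
    proof -
      have "0 < s x"
        using that by (simp add: s_eq power_strict_mono)
      moreover have "K * s x < 1"
        using e(2)[of x] that \<open>0 < K\<close> by (simp add: dist_commute pos_less_divide_eq mult.commute)
      ultimately have "(K * s x) * s x < 1 * s x"
        by (intro mult_strict_right_mono)
      then show ?thesis
        by (simp add: v_def)
    qed
    show "0 < elliptic_op (a x) (b x) v x" if "x \<in> ball p e" for x
      using e(2)[of x] that by (simp add: Lv dist_commute)
  qed
qed

text \<open>If \<open>h\<close> were negative at a point \<open>q\<close> near \<open>x0\<close>, a
  ball around \<open>q\<close> could be enlarged until it touches the zero set at some
  \<open>p\<close>. Adding a small multiple of the barrier at \<open>p\<close> gives a function with
  an interior maximum at which the operator is strictly positive, which is impossible.\<close>

theorem strong_maximum_principle: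
  fixes h :: "real^'m::finite \<Rightarrow> real" and a :: "real^'m \<Rightarrow> 'm \<Rightarrow> 'm \<Rightarrow> real"
  assumes S: "open S" "x0 \<in> S" and h: "twice_differentiable_on S h"
    and a: "\<And>i j. continuous_on S (\<lambda>x. a x i j)" and b: "\<And>k. continuous_on S (\<lambda>x. b x k)"
    and sym: "\<And>x i j. x \<in> S \<Longrightarrow> a x i j = a x j i"
    and pos: "\<And>x v. x \<in> S \<Longrightarrow> v \<noteq> 0 \<Longrightarrow> 0 < (\<Sum>i\<in>UNIV. \<Sum>j\<in>UNIV. a x i j * v $ i * v $ j)"
    and sub: "\<And>x. x \<in> S \<Longrightarrow> 0 \<le> elliptic_op (a x) (b x) h x"
    and le: "\<And>x. x \<in> S \<Longrightarrow> h x \<le> 0" and "h x0 = 0"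
  obtains r where "0 < r" "ball x0 r \<subseteq> S" "\<And>x. x \<in> ball x0 r \<Longrightarrow> h x = 0"
proof -
  obtain R where R: "0 < R" "cball x0 R \<subseteq> S"
    using S open_contains_cball by blast
  have cont: "continuous_on S h"
    using twice_differentiable_onD(1)[OF h]
    by (auto intro!: continuous_at_imp_continuous_on differentiable_imp_continuous_within)
  have "h q = 0" if "q \<in> ball x0 (R / 2)" for q
  proof (rule ccontr)
    assume "h q \<noteq> 0"
    define Z where "Z = {x \<in> cball x0 R. h x = 0}"
    have "closed Z"
      unfolding Z_def
      by (rule continuous_closed_preimage_constant)
        (use continuous_on_subset[OF cont R(2)] in auto)
    moreover have "x0 \<in> Z"
      using R \<open>h x0 = 0\<close> by (simp add: Z_def)
    ultimately obtain p where p: "p \<in> Z" "\<And>y. y \<in> Z \<Longrightarrow> dist q p \<le> dist q y"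
      using distance_attains_inf[of Z q] by auto
    define \<rho> where "\<rho> = dist q p"
    \<comment> \<open>Since \<open>x0\<close> itself is a zero, the touching ball reaches no farther
      than \<open>x0\<close> does from \<open>q\<close>, and so it stays within the ball of radius
      \<open>R\<close> around \<open>x0\<close>.\<close>
    have "\<rho> < R / 2"
      using p(2)[OF \<open>x0 \<in> Z\<close>] that by (simp add: \<rho>_def dist_commute)
    then have sub_ball: "cball q \<rho> \<subseteq> ball x0 R"
      using that by (intro cball_subset_ball_iff[THEN iffD2]) (auto simp: dist_commute)
    have neg: "h x < 0" if "x \<in> ball q \<rho>" for x
    proof -
      have "x \<in> cball x0 R"
        using sub_ball that ball_subset_cball by blast
      moreover have "x \<notin> Z"
        using p(2)[of x] that by (auto simp: \<rho>_def)
      ultimately show ?thesis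
        using le R(2) by (force simp: Z_def)
    qed
    have "p \<noteq> q"
      using p(1) \<open>h q \<noteq> 0\<close> by (auto simp: Z_def)
    \<comment> \<open>The ball of half the radius, tangent from inside at \<open>p\<close>, meets
      the closed touching ball's boundary only at \<open>p\<close>. Thus \<open>h\<close> is
      negative on the whole closed smaller ball except at \<open>p\<close>.\<close>
    define z where "z = midpoint q p"
    have z: "dist z p = \<rho> / 2" "dist q z = \<rho> / 2"
      by (auto simp: z_def \<rho>_def dist_midpoint)
    have "p \<noteq> z"
      using z(1) \<open>p \<noteq> q\<close> by (auto simp: \<rho>_def)
    have neg': "h x < 0" if "x \<noteq> p" "dist z x \<le> dist z p" for x
    proof (rule neg, rule ccontr)
      assume "x \<notin> ball q \<rho>"
      then have "\<rho> \<le> dist q x"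
        by simp
      moreover have "dist q x \<le> dist q z + dist z x"
        by (rule dist_triangle)
      ultimately have eq: "dist q x = dist q z + dist z x" "dist z x = \<rho> / 2"
        using that(2) z by auto
      \<comment> \<open>Equality in the triangle inequality puts \<open>q\<close>, \<open>z\<close>,
        \<open>x\<close> on one ray; with equal distances, \<open>x\<close> is the reflection of
        \<open>q\<close> in \<open>z\<close>, which is \<open>p\<close>.\<close>
      then have "norm (z - q) *\<^sub>R (x - z) = norm (x - z) *\<^sub>R (z - q)"
        using norm_triangle_eq[of "z - q" "x - z"] by (simp add: dist_norm norm_minus_commute)
      moreover have "norm (z - q) = \<rho> / 2" "norm (x - z) = \<rho> / 2" "\<rho> \<noteq> 0"
        using z eq \<open>p \<noteq> q\<close> by (auto simp: dist_norm norm_minus_commute \<rho>_def)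
      ultimately have "x - z = z - q"
        by simp
      then have "x = 2 *\<^sub>R z - q"
        by (metis add_diff_eq diff_add_cancel add.commute scaleR_2)
      also have "\<dots> = p"
        by (simp add: z_def midpoint_def scaleR_2)
      finally show False
        using that(1) by simp
    qed
    have p_S: "p \<in> ball x0 R" "p \<in> S"
    proof -
      have "p \<in> cball q \<rho>"
        by (simp add: \<rho>_def)
      then show "p \<in> ball x0 R"
        using sub_ball by blast
      then show "p \<in> S"
        using R(2) by auto
    qed
    obtain e v where e: "0 < e" "ball p e \<subseteq> S" and v: "twice_differentiable_on S v"
      "continuous_on UNIV v" "v p = 0"
      and v_neg: "\<And>x. x \<in> ball p e \<Longrightarrow> dist z p < dist z x \<Longrightarrow> v x < 0"
      and Lv: "\<And>x. x \<in> ball p e \<Longrightarrow> 0 < elliptic_op (a x) (b x) v x"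
      by (rule hopf_barrier[where a = a and b = b, OF S(1) p_S(2) \<open>p \<noteq> z\<close> a b sym pos[OF p_S(2)]])
        (assumption | (rule that; blast))+
    define d where "d = e / 2"
    have d: "0 < d" "cball p d \<subseteq> ball p e"
      using e by (auto simp: d_def)
    \<comment> \<open>The part of the small sphere where the barrier need not be negative. It is
      compact and avoids \<open>p\<close>, so \<open>h\<close> is bounded away from 0 on it.\<close>
    define C where "C = sphere p d \<inter> cball z (dist z p)"
    have "compact C"
      by (simp add: C_def compact_Int_closed)
    have C_sub: "C \<subseteq> S" "p \<notin> C"
      using d e by (auto simp: C_def)
    obtain \<delta> where \<delta>: "0 < \<delta>" "\<And>x. x \<in> C \<Longrightarrow> h x + \<delta> * v x < 0"
    proof (cases "C = {}")
      case True
      then show ?thesis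
        using that[of 1] by simp
    next
      case False
      obtain m where m: "m \<in> C" "\<And>x. x \<in> C \<Longrightarrow> h x \<le> h m"
        using continuous_attains_sup[OF \<open>compact C\<close> False continuous_on_subset[OF cont C_sub(1)]] by auto
      obtain n where n: "\<And>x. x \<in> C \<Longrightarrow> v x \<le> v n"
        using continuous_attains_sup[OF \<open>compact C\<close> False continuous_on_subset[OF v(2)]] by auto
      have "h m < 0"
        using m(1) C_sub by (intro neg') (auto simp: C_def)
      \<comment> \<open>Sized so that the barrier uses up at most half of the gap between the
        maximum \<open>h m\<close> on \<open>C\<close> and 0.\<close>
      define \<delta> where "\<delta> = - h m / (2 * (\<bar>v n\<bar> + 1))"
      have "0 < \<delta>"
        using \<open>h m < 0\<close> unfolding \<delta>_def by (intro divide_pos_pos) (simp_all add: add_nonneg_pos)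
      moreover have "h x + \<delta> * v x < 0" if "x \<in> C" for x
      proof -
        have "\<delta> * v x \<le> \<delta> * (\<bar>v n\<bar> + 1)"
          using n[OF that] \<open>0 < \<delta>\<close> by (intro mult_left_mono) auto
        also have "\<dots> = - h m / 2"
          using abs_ge_zero[of "v n"] by (simp add: \<delta>_def add_nonneg_eq_0_iff field_simps)
        finally show ?thesis
          using m(2)[OF that] \<open>h m < 0\<close> by simp
      qed
      ultimately show ?thesis
        using that by blast
    qed
    define w where "w x = h x + \<delta> * v x" for x
    have dv: "twice_differentiable_on S (\<lambda>x. \<delta> * v x)"
      by (intro twice_differentiable_on_mult S v twice_differentiable_on_const)
    have w: "twice_differentiable_on S w"
      unfolding w_def by (intro twice_differentiable_on_add S h dv)
    have "continuous_on (cball p d) w"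
      unfolding w_def
      using continuous_on_subset[OF cont] continuous_on_subset[OF v(2)] d(2) e(2)
      by (intro continuous_intros) auto
    then obtain y where y: "y \<in> cball p d" "\<And>x. x \<in> cball p d \<Longrightarrow> w x \<le> w y"
      using continuous_attains_sup[of "cball p d" w] d(1) by auto
    have "0 \<le> w y"
      using y(2)[of p] d(1) p(1) v(3) by (simp add: w_def Z_def)
    \<comment> \<open>On the small sphere \<open>w\<close> is negative everywhere: on
      \<open>C\<close> by the choice of \<open>\<delta>\<close>, off \<open>C\<close> because the
      barrier is negative there and \<open>h\<close> is nonpositive. At the centre
      \<open>w p = 0\<close>, so the maximum is interior.\<close>
    have "y \<in> ball p d"
    proof (rule ccontr)
      assume "y \<notin> ball p d"
      then have y': "y \<in> sphere p d"
        using y(1) by auto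
      show False
      proof (cases "y \<in> C")
        case True
        then show False
          using \<delta>(2)[OF True] \<open>0 \<le> w y\<close> by (simp add: w_def)
      next
        case False
        then have "v y < 0"
          using y' y(1) d(2) by (intro v_neg) (auto simp: C_def)
        moreover have "h y \<le> 0"
          using y(1) d(2) e(2) by (intro le) auto
        ultimately show False
          using \<open>0 \<le> w y\<close> \<delta>(1) by (simp add: w_def mult_pos_neg add_nonpos_neg flip: not_less)
      qed
    qed
    have y_S: "y \<in> S" "y \<in> ball p e"
      using y(1) d(2) e(2) by auto
    have "elliptic_op (a y) (b y) w y \<le> 0"
    proof (rule elliptic_op_nonpos_at_max[OF open_ball \<open>y \<in> ball p d\<close>])
      show "twice_differentiable_on (ball p d) w"
        using w d(2) e(2) ball_subset_cball[of p d] unfolding twice_differentiable_on_def by blast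
      show "w x \<le> w y" if "x \<in> ball p d" for x
        using y(2) that by simp
      show "a y i j = a y j i" for i j
        using sym y_S(1) by blast
      show "0 \<le> (\<Sum>i\<in>UNIV. \<Sum>j\<in>UNIV. a y i j * u $ i * u $ j)" for u :: "real^'m"
        using pos[OF y_S(1), of u] by (cases "u = 0") auto
    qed
    moreover have "elliptic_op (a y) (b y) w y
        = elliptic_op (a y) (b y) h y + \<delta> * elliptic_op (a y) (b y) v y"
      unfolding w_def
      by (simp add: elliptic_op_add[OF S(1) y_S(1) h dv] elliptic_op_cmult[OF S(1) y_S(1) v(1)])
    ultimately show False
      using sub[OF y_S(1)] mult_pos_pos[OF \<delta>(1) Lv[OF y_S(2)]] by linarith
  qed
  then show thesis
    using R that[of "R / 2"] by (force simp: subset_iff)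
qed

section \<open>Regularity of smooth maps and their components\<close>

lemma smooth_onD:
  assumes "smooth_on S F" "x \<in> S"
  shows "F differentiable (at x)" "(\<lambda>y. frechet_derivative F (at y) v) differentiable (at x)"
proof -
  have "Ck_on (Suc (Suc 0)) S F"
    using assms(1) unfolding smooth_on_def by blast
  then show "F differentiable (at x)" "(\<lambda>y. frechet_derivative F (at y) v) differentiable (at x)"
    using assms(2) by auto
qed

lemma smooth_on_imp_continuous_on:
  assumes "smooth_on S F"
  shows "continuous_on S F"
  using smooth_onD(1)[OF assms]
  by (intro continuous_at_imp_continuous_on ballI differentiable_imp_continuous_within)

text \<open>Serves coordinates of a map and entries of a metric alike: a bounded linear
  \<open>L\<close> commutes with differentiation.\<close>

lemma twice_differentiable_on_bounded_linear:
  fixes F :: "real^'m::finite \<Rightarrow> 'b::real_normed_vector"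
  assumes S: "open S" and F: "smooth_on S F" and L: "bounded_linear L"
  shows "twice_differentiable_on S (\<lambda>x. L (F x))"
proof -
  have D: "((\<lambda>x. L (F x)) has_derivative (\<lambda>v. L (frechet_derivative F (at x) v))) (at x)"
    if "x \<in> S" for x
    using bounded_linear.has_derivative[OF L] smooth_onD(1)[OF F that]
    by (metis frechet_derivative_works)
  have "partial_deriv i (\<lambda>x. L (F x)) differentiable (at x)" if x: "x \<in> S" for i x
  proof (rule differentiable_cong_open[OF _ S x])
    show "(\<lambda>y. L (frechet_derivative F (at y) (axis i 1))) differentiable (at x)"
      using bounded_linear.has_derivative[OF L] smooth_onD(2)[OF F x]
      unfolding differentiable_def by blast
  qed (simp add: partial_deriv_eq[OF D])
  then show ?thesis
    using D by (auto simp: twice_differentiable_on_def differentiable_def)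
qed

lemma continuous_on_partial_deriv:
  assumes "twice_differentiable_on S h"
  shows "continuous_on S h" "continuous_on S (partial_deriv i h)"
  using twice_differentiable_onD[OF assms]
  by (auto intro!: continuous_at_imp_continuous_on differentiable_imp_continuous_within)

subsection \<open>Inverse matrices\<close>

lemma
  fixes B :: "'a::field^'m^'m"
  assumes "invertible B"
  shows matrix_inv_right: "B ** matrix_inv B = mat 1"
    and matrix_inv_left: "matrix_inv B ** B = mat 1"
  using someI_ex[OF assms[unfolded invertible_def]] by (simp_all add: matrix_inv_def)

lemma matrix_inv_unique:
  fixes B :: "'a::field^'m^'m"
  assumes "B ** C = mat 1"
  shows "matrix_inv B = C"
proof -
  have "invertible B"
    using assms matrix_left_right_inverse[of B C] by (auto simp: invertible_def)
  then have "matrix_inv B ** (B ** C) = C"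
    by (simp add: matrix_inv_left matrix_mul_assoc)
  then show ?thesis
    by (simp add: assms)
qed

text \<open>By Cramer's rule each entry of the inverse is a quotient of determinants, which are
  polynomials in the entries.\<close>

lemma continuous_on_matrix_inv:
  fixes G :: "'b::topological_space \<Rightarrow> real^'m^'m"
  assumes G: "\<And>i j. continuous_on S (\<lambda>x. G x $ i $ j)"
    and inv: "\<And>x. x \<in> S \<Longrightarrow> invertible (G x)"
  shows "continuous_on S (\<lambda>x. matrix_inv (G x) $ k $ l)"
proof -
  have det: "continuous_on S (\<lambda>x. det (B x))"
    if "\<And>i j. continuous_on S (\<lambda>x. B x $ i $ j)" for B :: "'b \<Rightarrow> real^'m^'m"
    unfolding det_def by (intro continuous_intros that)
  \<comment> \<open>\<open>G x\<close> with column \<open>k\<close> replaced by the basis vector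
    \<open>axis l 1\<close>: the numerator in Cramer's rule for the entry in row \<open>k\<close>
    and column \<open>l\<close>.\<close>
  define B where "B x = (\<chi> i j. if j = k then axis l 1 $ i else G x $ i $ j)" for x
  have "matrix_inv (G x) $ k $ l = det (B x) / det (G x)" if "x \<in> S" for x
  proof -
    have "G x *v (matrix_inv (G x) *v axis l 1) = axis l 1"
      by (simp add: matrix_vector_mul_assoc matrix_inv_right inv that)
    then have "(matrix_inv (G x) *v axis l 1) $ k = det (B x) / det (G x)"
      using cramer[of "G x"] inv[OF that] by (auto simp: invertible_det_nz B_def)
    then show ?thesis
      by (simp add: matrix_vector_mult_basis column_def)
  qed
  moreover have "continuous_on S (\<lambda>x. det (B x) / det (G x))"
  proof (intro continuous_on_divide det G)
    show "continuous_on S (\<lambda>x. B x $ i $ j)" for i j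
      by (cases "j = k") (simp_all add: B_def G)
    show "\<forall>x\<in>S. det (G x) \<noteq> 0"
      using inv by (simp add: invertible_det_nz)
  qed
  ultimately show ?thesis
    by (simp cong: continuous_on_cong)
qed

lemma quadratic_form_eq:
  fixes B :: "real^'m^'m"
  shows "v \<bullet> (B *v v) = (\<Sum>i\<in>UNIV. \<Sum>j\<in>UNIV. B $ i $ j * v $ i * v $ j)"
  by (simp add: inner_vec_def matrix_vector_mult_def sum_distrib_left algebra_simps)

text \<open>A positive definite matrix has trivial kernel. Transposing the inverse identity gives
  symmetry, and substituting \<open>v = B *v w\<close> turns the form of the inverse at
  \<open>v\<close> into the form of \<open>B\<close> at \<open>w\<close>.\<close>

lemma
  fixes B :: "real^'m^'m"
  assumes sym: "transpose B = B" and pos: "\<And>v. v \<noteq> 0 \<Longrightarrow> 0 < v \<bullet> (B *v v)"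
  shows invertible_if_positive_definite: "invertible B"
    and matrix_inv_symmetric: "matrix_inv B $ i $ j = matrix_inv B $ j $ i"
    and matrix_inv_positive_definite: "v \<noteq> 0 \<Longrightarrow> 0 < v \<bullet> (matrix_inv B *v v)"
proof -
  have "\<forall>x. B *v x = 0 \<longrightarrow> x = 0"
    using pos by force
  then show inv: "invertible B"
    by (simp add: invertible_left_inverse matrix_left_invertible_ker)
  have "transpose (matrix_inv B) ** B = mat 1"
    using matrix_inv_right[OF inv] sym by (metis matrix_transpose_mul transpose_mat)
  then have "transpose (matrix_inv B) = matrix_inv B"
    using matrix_inv_right[OF inv] by (metis matrix_mul_assoc matrix_mul_lid matrix_mul_rid)
  then have "transpose (matrix_inv B) $ j $ i = matrix_inv B $ j $ i"
    by (rule arg_cong)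
  then show "matrix_inv B $ i $ j = matrix_inv B $ j $ i"
    by (simp add: transpose_def)
  assume "v \<noteq> 0"
  define w where "w = matrix_inv B *v v"
  have w: "B *v w = v"
    by (simp add: w_def matrix_vector_mul_assoc matrix_inv_right[OF inv])
  then have "w \<noteq> 0"
    using \<open>v \<noteq> 0\<close> by auto
  then show "0 < v \<bullet> (matrix_inv B *v v)"
    using pos[of w] w by (simp add: inner_commute flip: w_def)
qed

subsection \<open>Harmonic maps into the upper half-space\<close>

text \<open>The metric is a conformal factor times the identity, and the factor depends on the last
  coordinate alone. So only derivatives of diagonal entries in direction \<open>t\<close> survive,
  each equal to \<open>- 2 / (y $ t) ^ 3\<close>; half the inverse factor turns this into
  \<open>- 1 / y $ t\<close>.\<close>

lemma christoffel_hyperbolic: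
  fixes y :: "real^'n::{finite,linorder}"
  assumes y: "0 < last_coord y"
  defines "t \<equiv> Max (UNIV :: 'n set)"
  shows "christoffel hyperbolic_metric \<alpha> \<beta> \<gamma> y = - (1 / last_coord y) *
    ((if \<beta> = t \<and> \<gamma> = \<alpha> then 1 else 0) + (if \<gamma> = t \<and> \<beta> = \<alpha> then 1 else 0)
      - (if \<alpha> = t \<and> \<beta> = \<gamma> then 1 else 0))"
proof -
  have yt: "last_coord z = z $ t" for z :: "real^'n::{finite,linorder}"
    by (simp add: last_coord_def t_def)
  have pos: "0 < y $ t"
    using y by (simp add: yt)
  have pd: "partial_deriv \<beta> (\<lambda>y. hyperbolic_metric y $ \<gamma> $ l) y
      = (if \<beta> = t \<and> \<gamma> = l then - 2 / (y $ t) ^ 3 else 0)" for \<beta> \<gamma> l :: 'n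
  proof -
    have "((\<lambda>y. 1 / (y $ t)\<^sup>2 * (if \<gamma> = l then 1 else 0)) has_derivative
        (\<lambda>v. - 2 / (y $ t) ^ 3 * v $ t * (if \<gamma> = l then 1 else 0))) (at y)"
      using pos
      by (auto intro!: derivative_eq_intros bounded_linear_imp_has_derivative
          bounded_linear_vec_nth ext simp: field_simps power2_eq_square power3_eq_cube)
    moreover have "(\<lambda>y. hyperbolic_metric y $ \<gamma> $ l) = (\<lambda>y. 1 / (y $ t)\<^sup>2 * (if \<gamma> = l then 1 else 0))"
      by (auto simp: hyperbolic_metric_def yt mat_def)
    ultimately show ?thesis
      using partial_deriv_eq[of "\<lambda>y. hyperbolic_metric y $ \<gamma> $ l" _ y \<beta>] by (auto simp: axis_def)
  qed
  have "matrix_inv (hyperbolic_metric y) = (y $ t)\<^sup>2 *\<^sub>R mat 1"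
  proof -
    have "hyperbolic_metric y ** ((y $ t)\<^sup>2 *\<^sub>R mat 1) = mat 1"
      using pos by (simp add: hyperbolic_metric_def yt matrix_scalar_ac flip: scalar_matrix_assoc)
    then show ?thesis
      by (rule matrix_inv_unique)
  qed
  then have inv: "matrix_inv (hyperbolic_metric y) $ \<alpha> $ l = (if \<alpha> = l then (y $ t)\<^sup>2 else 0)" for l
    by (simp add: mat_def)
  have delta: "(\<Sum>l\<in>UNIV. (if \<alpha> = l then q else 0) * Z l) = q * Z \<alpha>" for q and Z :: "'n \<Rightarrow> real"
  proof -
    have "(\<Sum>l\<in>UNIV. (if \<alpha> = l then q else 0) * Z l) = (\<Sum>l\<in>UNIV. if \<alpha> = l then q * Z l else 0)"
      by (intro sum.cong) auto
    then show ?thesis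
      by simp
  qed
  have if_mult: "(if P then q else 0) = q * (if P then 1 else 0)" for P and q :: real
    by simp
  have factor: "k * (q * r1 + q * r2 - q * r3) = (k * q) * (r1 + r2 - r3)" for k q r1 r2 r3 :: real
    by (simp add: algebra_simps)
  have "christoffel hyperbolic_metric \<alpha> \<beta> \<gamma> y = (1 / 2) * (y $ t)\<^sup>2 *
      ((if \<beta> = t \<and> \<gamma> = \<alpha> then - 2 / (y $ t) ^ 3 else 0)
       + (if \<gamma> = t \<and> \<beta> = \<alpha> then - 2 / (y $ t) ^ 3 else 0)
       - (if \<alpha> = t \<and> \<beta> = \<gamma> then - 2 / (y $ t) ^ 3 else 0))"
    unfolding christoffel_def pd inv delta by (simp only: mult.assoc eq_commute[of l \<alpha> for l])
  also have "\<dots> = ((1 / 2) * (y $ t)\<^sup>2 * (- 2 / (y $ t) ^ 3)) *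
    ((if \<beta> = t \<and> \<gamma> = \<alpha> then 1 else 0) + (if \<gamma> = t \<and> \<beta> = \<alpha> then 1 else 0)
      - (if \<alpha> = t \<and> \<beta> = \<gamma> then 1 else 0))"
    unfolding if_mult[of _ "- 2 / (y $ t) ^ 3"] by (rule factor)
  also have "(1 / 2) * (y $ t)\<^sup>2 * (- 2 / (y $ t) ^ 3) = - (1 / last_coord y)"
    using pos by (simp add: yt power2_eq_square power3_eq_cube)
  finally show ?thesis .
qed

text \<open>With \<open>u\<close> the last coordinate of \<open>F\<close>, the drift \<open>-2 \<langle>\<nabla>u, \<nabla>\<cdot>\<rangle> / u\<close> added to the Laplacian cancels
  the mixed Christoffel terms of the target.\<close>

lemma elliptic_op_hyperbolic_coordinate:
  fixes F :: "real^'m::finite \<Rightarrow> real^'n::{finite,linorder}"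
  assumes tension: "tension_field G hyperbolic_metric F x = 0" and height: "0 < last_coord (F x)"
    and sym: "\<And>i j. matrix_inv (G x) $ i $ j = matrix_inv (G x) $ j $ i"
  defines "a \<equiv> \<lambda>i j. matrix_inv (G x) $ i $ j"
    and "X \<equiv> \<lambda>\<alpha> i. partial_deriv i (\<lambda>y. F y $ \<alpha>) x"
    and "t \<equiv> Max (UNIV :: 'n set)"
  defines "b \<equiv> \<lambda>k. (\<Sum>i\<in>UNIV. \<Sum>j\<in>UNIV. a i j * christoffel G k i j x)
      + 2 / last_coord (F x) * (\<Sum>j\<in>UNIV. a k j * X t j)"
  shows "elliptic_op a b (\<lambda>y. F y $ \<alpha>) x
    = (if \<alpha> = t then - (\<Sum>\<beta>\<in>UNIV. \<Sum>i\<in>UNIV. \<Sum>j\<in>UNIV. a i j * X \<beta> i * X \<beta> j) / last_coord (F x)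
       else 0)"
proof -
  let ?u = "last_coord (F x)"
  let ?H = "\<lambda>i j. partial_deriv i (partial_deriv j (\<lambda>y. F y $ \<alpha>)) x"
  \<comment> \<open>The squared norm of the differential, with \<open>G\<close> on the domain and
    the Euclidean metric on the target. \<open>T\<close> below pairs the gradients of the last
    coordinate and of coordinate \<open>\<alpha>\<close>.\<close>
  let ?E = "\<Sum>\<beta>\<in>UNIV. \<Sum>i\<in>UNIV. \<Sum>j\<in>UNIV. a i j * X \<beta> i * X \<beta> j"
  define T where "T = (\<Sum>i\<in>UNIV. \<Sum>j\<in>UNIV. a i j * X t i * X \<alpha> j)"
  define \<Gamma> where "\<Gamma> = (\<Sum>k\<in>UNIV. (\<Sum>i\<in>UNIV. \<Sum>j\<in>UNIV. a i j * christoffel G k i j x) * X \<alpha> k)"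
  have swap: "(\<Sum>i\<in>UNIV. \<Sum>j\<in>UNIV. a i j * X \<alpha> i * X t j) = T"
    unfolding T_def by (subst sum.swap) (simp add: a_def sym[of i j for i j] mult.commute mult.left_commute)
  \<comment> \<open>The three Kronecker terms of the target symbols give two mixed products and, for
    \<open>\<alpha> = t\<close> only, the Euclidean product of the partial derivatives.\<close>
  have target: "(\<Sum>\<beta>\<in>UNIV. \<Sum>\<gamma>\<in>UNIV. christoffel hyperbolic_metric \<alpha> \<beta> \<gamma> (F x) * X \<beta> i * X \<gamma> j)
      = - (1 / ?u) * (X t i * X \<alpha> j + X \<alpha> i * X t j
          - (if \<alpha> = t then \<Sum>\<beta>\<in>UNIV. X \<beta> i * X \<beta> j else 0))" for i j
  proof -
    have delta: "(\<Sum>\<beta>\<in>UNIV. \<Sum>\<gamma>\<in>UNIV. if \<beta> = p then if \<gamma> = q then X \<beta> i * X \<gamma> j else 0 else 0)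
        = X p i * X q j" for p q
    proof -
      have "(\<Sum>\<gamma>\<in>UNIV. if \<beta> = p then if \<gamma> = q then X \<beta> i * X \<gamma> j else 0 else 0)
          = (if \<beta> = p then X \<beta> i * X q j else 0)" for \<beta>
        by (cases "\<beta> = p") simp_all
      then show ?thesis
        by simp
    qed
    have "(\<Sum>\<beta>\<in>UNIV. \<Sum>\<gamma>\<in>UNIV. christoffel hyperbolic_metric \<alpha> \<beta> \<gamma> (F x) * X \<beta> i * X \<gamma> j)
      = (\<Sum>\<beta>\<in>UNIV. \<Sum>\<gamma>\<in>UNIV. - (1 / ?u) *
          ((if \<beta> = t then if \<gamma> = \<alpha> then X \<beta> i * X \<gamma> j else 0 else 0)
           + (if \<beta> = \<alpha> then if \<gamma> = t then X \<beta> i * X \<gamma> j else 0 else 0)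
           - (if \<gamma> = \<beta> then if \<alpha> = t then X \<beta> i * X \<gamma> j else 0 else 0)))"
      by (intro sum.cong refl) (auto simp: christoffel_hyperbolic[OF height] t_def)
    also have "\<dots> = - (1 / ?u) * (X t i * X \<alpha> j + X \<alpha> i * X t j
        - (\<Sum>\<beta>\<in>UNIV. \<Sum>\<gamma>\<in>UNIV. if \<gamma> = \<beta> then if \<alpha> = t then X \<beta> i * X \<gamma> j else 0 else 0))"
      unfolding sum_distrib_left[symmetric] sum_subtractf sum.distrib delta ..
    finally show ?thesis
      by simp
  qed
  have "0 = tension_field G hyperbolic_metric F x $ \<alpha>"
    by (simp add: tension)
  also have "\<dots> = (\<Sum>i\<in>UNIV. \<Sum>j\<in>UNIV. a i j * ?H i j)
      - (\<Sum>i\<in>UNIV. \<Sum>j\<in>UNIV. \<Sum>k\<in>UNIV. a i j * christoffel G k i j x * X \<alpha> k)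
      + (\<Sum>i\<in>UNIV. \<Sum>j\<in>UNIV. a i j * (- (1 / ?u) * (X t i * X \<alpha> j + X \<alpha> i * X t j
          - (if \<alpha> = t then \<Sum>\<beta>\<in>UNIV. X \<beta> i * X \<beta> j else 0))))"
    unfolding target[symmetric]
    by (simp add: tension_field_def second_fundamental_form_def sum.distrib sum_subtractf
        ring_distribs sum_distrib_left a_def X_def mult.assoc)
  also have "(\<Sum>i\<in>UNIV. \<Sum>j\<in>UNIV. \<Sum>k\<in>UNIV. a i j * christoffel G k i j x * X \<alpha> k) = \<Gamma>"
    unfolding \<Gamma>_def sum_distrib_right
    by (subst (2) sum.swap) (subst sum.swap, simp)
  also have "(\<Sum>i\<in>UNIV. \<Sum>j\<in>UNIV. a i j * (- (1 / ?u) * (X t i * X \<alpha> j + X \<alpha> i * X t j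
          - (if \<alpha> = t then \<Sum>\<beta>\<in>UNIV. X \<beta> i * X \<beta> j else 0))))
      = - (1 / ?u) * (T + T - (if \<alpha> = t then ?E else 0))"
  proof -
    have E: "(\<Sum>i\<in>UNIV. \<Sum>j\<in>UNIV. a i j * (\<Sum>\<beta>\<in>UNIV. X \<beta> i * X \<beta> j)) = ?E"
      unfolding sum_distrib_left
      by (subst (2) sum.swap) (subst sum.swap, simp add: mult.assoc)
    have "(\<Sum>i\<in>UNIV. \<Sum>j\<in>UNIV. a i j * (- (1 / ?u) * (X t i * X \<alpha> j + X \<alpha> i * X t j
          - (if \<alpha> = t then \<Sum>\<beta>\<in>UNIV. X \<beta> i * X \<beta> j else 0))))
      = - (1 / ?u) * ((\<Sum>i\<in>UNIV. \<Sum>j\<in>UNIV. a i j * X t i * X \<alpha> j)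
         + (\<Sum>i\<in>UNIV. \<Sum>j\<in>UNIV. a i j * X \<alpha> i * X t j)
         - (\<Sum>i\<in>UNIV. \<Sum>j\<in>UNIV. a i j * (if \<alpha> = t then \<Sum>\<beta>\<in>UNIV. X \<beta> i * X \<beta> j else 0)))"
      unfolding sum_distrib_left sum.distrib[symmetric] sum_subtractf[symmetric]
      by (intro sum.cong refl) (simp only: ring_distribs mult.assoc mult.left_commute)
    then show ?thesis
      using E swap by (auto simp flip: T_def)
  qed
  finally have "(\<Sum>i\<in>UNIV. \<Sum>j\<in>UNIV. a i j * ?H i j) - \<Gamma>
      = (1 / ?u) * (T + T - (if \<alpha> = t then ?E else 0))"
    by linarith
  \<comment> \<open>The extra drift supplies exactly the \<open>2 * T / ?u\<close> left over from
    the two mixed products.\<close>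
  moreover have "(\<Sum>k\<in>UNIV. b k * X \<alpha> k) = \<Gamma> + 2 / ?u * T"
  proof -
    have "(\<Sum>k\<in>UNIV. b k * X \<alpha> k)
        = \<Gamma> + 2 / ?u * (\<Sum>k\<in>UNIV. \<Sum>j\<in>UNIV. a k j * X \<alpha> k * X t j)"
      unfolding \<Gamma>_def b_def sum_distrib_left sum.distrib[symmetric] ring_distribs sum_distrib_right
      by (simp add: mult.commute mult.left_commute sum_distrib_left)
    then show ?thesis
      using swap by simp
  qed
  moreover have "elliptic_op a b (\<lambda>y. F y $ \<alpha>) x
      = (\<Sum>i\<in>UNIV. \<Sum>j\<in>UNIV. a i j * ?H i j) - (\<Sum>k\<in>UNIV. b k * X \<alpha> k)"
    by (simp add: elliptic_op_def X_def)
  ultimately have "elliptic_op a b (\<lambda>y. F y $ \<alpha>) x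
      = (1 / ?u) * (T + T - (if \<alpha> = t then ?E else 0)) - 2 / ?u * T"
    by linarith
  also have "\<dots> = (if \<alpha> = t then - ?E / ?u else 0)"
    using height by (simp add: field_simps)
  finally show ?thesis .
qed

text \<open>By \<open>le\<close> and \<open>touch\<close>, the function \<open>h\<close> below has
  maximum 0 at \<open>x0\<close>. It is a subsolution, so it vanishes on a ball by the strong
  maximum principle; then the energy density vanishes there too, and ellipticity kills every partial
  derivative of \<open>F\<close>.\<close>

lemma hyperbolic_harmonic_locally_constant:
  fixes F :: "real^'m::finite \<Rightarrow> real^'n::{finite,linorder}"
  assumes S: "open S" "x0 \<in> S" and G: "riemannian_metric_on S G" and F: "smooth_on S F"
    and tension: "\<And>x. x \<in> S \<Longrightarrow> tension_field G hyperbolic_metric F x = 0"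
    and height: "\<And>x. x \<in> S \<Longrightarrow> 0 < last_coord (F x)" and "0 < A"
    and le: "\<And>x. x \<in> S \<Longrightarrow> 1 - \<epsilon> * (norm (F x))\<^sup>2 \<le> A * last_coord (F x)"
    and touch: "1 - \<epsilon> * (norm (F x0))\<^sup>2 = A * last_coord (F x0)"
  obtains r where "0 < r" "ball x0 r \<subseteq> S" "\<And>x. x \<in> ball x0 r \<Longrightarrow> F x = F x0"
proof -
  define t where "t = Max (UNIV :: 'n set)"
  define a where "a x i j = matrix_inv (G x) $ i $ j" for x i j
  define X where "X x \<alpha> i = partial_deriv i (\<lambda>y. F y $ \<alpha>) x" for x \<alpha> i
  define b where "b x k = (\<Sum>i\<in>UNIV. \<Sum>j\<in>UNIV. a x i j * christoffel G k i j x)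
      + 2 / last_coord (F x) * (\<Sum>j\<in>UNIV. a x k j * X x t j)" for x k
  define e where "e x \<beta> = (\<Sum>i\<in>UNIV. \<Sum>j\<in>UNIV. a x i j * X x \<beta> i * X x \<beta> j)" for x \<beta>
  define E where "E x = (\<Sum>\<beta>\<in>UNIV. e x \<beta>)" for x
  have last: "last_coord y = y $ t" for y :: "real^'n::{finite,linorder}"
    by (simp add: last_coord_def t_def)
  have sym_G: "transpose (G x) = G x" and pos_G: "\<And>v. v \<noteq> 0 \<Longrightarrow> 0 < v \<bullet> (G x *v v)"
    if "x \<in> S" for x
    using G that by (auto simp: riemannian_metric_on_def)
  have G_2: "twice_differentiable_on S (\<lambda>x. G x $ i $ j)" for i j
    using G bounded_linear_compose[OF bounded_linear_vec_nth bounded_linear_vec_nth]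
    by (intro twice_differentiable_on_bounded_linear[OF S(1)]) (auto simp: riemannian_metric_on_def)
  have F_2: "twice_differentiable_on S (\<lambda>x. F x $ \<alpha>)" for \<alpha>
    by (intro twice_differentiable_on_bounded_linear[OF S(1) F] bounded_linear_vec_nth)
  note F_d = twice_differentiable_onD(1)[OF F_2]
  have a_cont: "continuous_on S (\<lambda>x. a x i j)" for i j
    unfolding a_def using sym_G pos_G
    by (intro continuous_on_matrix_inv continuous_on_partial_deriv(1)[OF G_2] invertible_if_positive_definite)
  have b_cont: "continuous_on S (\<lambda>x. b x k)" for k
    unfolding b_def christoffel_def a_def[symmetric] X_def last
    by (intro continuous_intros a_cont continuous_on_partial_deriv[OF G_2] continuous_on_partial_deriv[OF F_2]
        smooth_on_imp_continuous_on[OF F])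
      (auto simp: less_imp_neq[OF height, unfolded last, THEN not_sym])
  have a_sym: "a x i j = a x j i" if "x \<in> S" for x i j
    unfolding a_def by (rule matrix_inv_symmetric[OF sym_G[OF that] pos_G[OF that]])
  have a_pos: "0 < (\<Sum>i\<in>UNIV. \<Sum>j\<in>UNIV. a x i j * v $ i * v $ j)" if "x \<in> S" "v \<noteq> 0" for x v
    using matrix_inv_positive_definite[OF sym_G[OF that(1)] pos_G[OF that(1)] that(2)]
    by (simp add: a_def quadratic_form_eq)
  have e_nonneg: "0 \<le> e x \<beta>" if "x \<in> S" for x \<beta>
    using a_pos[OF that, of "\<chi> i. X x \<beta> i"] by (cases "(\<chi> i. X x \<beta> i) = 0") (auto simp: e_def vec_eq_iff)
  have op_coord: "elliptic_op (a x) (b x) (\<lambda>y. F y $ \<alpha>) x = (if \<alpha> = t then - E x / F x $ t else 0)"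
    if "x \<in> S" for x \<alpha>
  proof -
    have ab: "a x = (\<lambda>i j. matrix_inv (G x) $ i $ j)"
      "b x = (\<lambda>k. (\<Sum>i\<in>UNIV. \<Sum>j\<in>UNIV. matrix_inv (G x) $ i $ j * christoffel G k i j x)
        + 2 / last_coord (F x) *
          (\<Sum>j\<in>UNIV. matrix_inv (G x) $ k $ j * partial_deriv j (\<lambda>y. F y $ t) x))"
      by (simp_all add: a_def b_def X_def fun_eq_iff)
    show ?thesis
      unfolding ab E_def e_def a_def X_def
      using elliptic_op_hyperbolic_coordinate[OF tension[OF that] height[OF that]
          a_sym[OF that, unfolded a_def], of \<alpha>]
      by (simp add: last t_def)
  qed
  define h where "h x = 1 + ((- \<epsilon>) * (\<Sum>\<alpha>\<in>UNIV. F x $ \<alpha> * F x $ \<alpha>) + (- A) * F x $ t)" for x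
  have h_eq: "h x = 1 - \<epsilon> * (norm (F x))\<^sup>2 - A * last_coord (F x)" for x
    by (simp add: h_def last power2_norm_eq_inner inner_vec_def)
  note const = twice_differentiable_on_const
  have sq_2: "twice_differentiable_on S (\<lambda>x. F x $ \<alpha> * F x $ \<alpha>)" for \<alpha>
    by (intro twice_differentiable_on_mult S F_2)
  have sum_2: "twice_differentiable_on S (\<lambda>x. \<Sum>\<alpha>\<in>UNIV. F x $ \<alpha> * F x $ \<alpha>)"
    by (intro twice_differentiable_on_sum S sq_2) simp
  have parts_2: "twice_differentiable_on S (\<lambda>x. (- \<epsilon>) * (\<Sum>\<alpha>\<in>UNIV. F x $ \<alpha> * F x $ \<alpha>))"
    "twice_differentiable_on S (\<lambda>x. (- A) * F x $ t)"
    by (intro twice_differentiable_on_mult S sum_2 F_2 const)+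
  have rest_2: "twice_differentiable_on S (\<lambda>x. (- \<epsilon>) * (\<Sum>\<alpha>\<in>UNIV. F x $ \<alpha> * F x $ \<alpha>) + (- A) * F x $ t)"
    by (intro twice_differentiable_on_add S parts_2)
  have h_2: "twice_differentiable_on S h"
    unfolding h_def by (intro twice_differentiable_on_add S rest_2 const)
  have op_h: "elliptic_op (a x) (b x) h x = A * E x / F x $ t" if x: "x \<in> S" for x
  proof -
    have "0 < F x $ t"
      using height[OF x] by (simp add: last)
    have "elliptic_op (a x) (b x) (\<lambda>x. F x $ \<alpha> * F x $ \<alpha>) x = (if \<alpha> = t then - 2 * E x else 0) + 2 * e x \<alpha>"
      for \<alpha>
      using \<open>0 < F x $ t\<close>
      by (subst elliptic_op_mult[OF S(1) x F_2 F_2 a_sym[OF x]]) (simp add: op_coord[OF x] e_def X_def)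
    \<comment> \<open>The squared norm of \<open>F\<close> is annihilated: the
      \<open>- 2 * E x\<close> of the last coordinate cancels the sum of the gradient terms
      \<open>2 * e x \<alpha>\<close>.\<close>
    then have "elliptic_op (a x) (b x) (\<lambda>x. \<Sum>\<alpha>\<in>UNIV. F x $ \<alpha> * F x $ \<alpha>) x = 0"
      by (subst elliptic_op_sum[OF S(1) x finite sq_2]) (simp add: sum.distrib E_def flip: sum_distrib_left)
    then show ?thesis
      unfolding h_def
      by (simp only: elliptic_op_add[OF S(1) x const rest_2] elliptic_op_add[OF S(1) x parts_2]
          elliptic_op_const elliptic_op_cmult[OF S(1) x sum_2] elliptic_op_cmult[OF S(1) x F_2]
          op_coord[OF x]) simp
  qed
  obtain r where r: "0 < r" "ball x0 r \<subseteq> S" "\<And>x. x \<in> ball x0 r \<Longrightarrow> h x = 0"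
  proof (rule strong_maximum_principle[where a = a and b = b, OF S h_2 a_cont b_cont a_sym a_pos])
    show "0 \<le> elliptic_op (a x) (b x) h x" if "x \<in> S" for x
    proof -
      have "0 \<le> E x"
        unfolding E_def by (intro sum_nonneg e_nonneg that)
      then show ?thesis
        using height[OF that] \<open>0 < A\<close> by (simp add: op_h[OF that] last)
    qed
    show "h x \<le> 0" if "x \<in> S" for x
      using le[OF that] by (simp add: h_eq)
    show "h x0 = 0"
      using touch by (simp add: h_eq)
  qed (assumption | (rule that; blast))+
  have X_0: "X x \<alpha> i = 0" if x: "x \<in> ball x0 r" for x \<alpha> i
  proof -
    have "x \<in> S"
      using x r(2) by blast
    \<comment> \<open>On the ball \<open>h\<close> is identically 0, so the formula
      \<open>A * E x / F x $ t\<close> must give 0.\<close>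
    have "elliptic_op (a x) (b x) h x = elliptic_op (a x) (b x) (\<lambda>_. 0) x"
      by (rule elliptic_op_cong[OF open_ball x r(3)])
    then have "E x = 0"
      using height[OF \<open>x \<in> S\<close>] \<open>0 < A\<close> by (simp add: op_h[OF \<open>x \<in> S\<close>] elliptic_op_const last)
    then have "e x \<alpha> = 0"
      unfolding E_def by (subst (asm) sum_nonneg_eq_0_iff) (auto simp: e_nonneg[OF \<open>x \<in> S\<close>])
    then have "(\<chi> i. X x \<alpha> i) = 0"
      using a_pos[OF \<open>x \<in> S\<close>, of "\<chi> i. X x \<alpha> i"] by (auto simp: e_def)
    then show ?thesis
      by (simp add: vec_eq_iff)
  qed
  have "F x = F x0" if x: "x \<in> ball x0 r" for x
  proof -
    have "F x $ \<alpha> = F x0 $ \<alpha>" for \<alpha>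
    proof -
      have "((\<lambda>y. F y $ \<alpha>) has_derivative (\<lambda>v. 0)) (at y within ball x0 r)" if "y \<in> ball x0 r" for y
      proof -
        have "y \<in> S"
          using that r(2) by blast
        then show ?thesis
          using has_derivative_partial_deriv[OF F_d[OF \<open>y \<in> S\<close>, of \<alpha>]] X_0[OF that]
          by (simp add: X_def has_derivative_at_withinI)
      qed
      then obtain c where "\<And>y. y \<in> ball x0 r \<Longrightarrow> F y $ \<alpha> = c"
        using has_derivative_zero_constant[OF convex_ball] by metis
      then show ?thesis
        using x r(1) by simp
    qed
    then show ?thesis
      by (simp add: vec_eq_iff)
  qed
  then show thesis
    using r that by blast
qed

text \<open>The last coordinate is at least \<open>c > 0\<close>, so the second inequality bounds
  the Euclidean norm. Nonstrict inequalities make the set closed, and \<open>c\<close> keeps it off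
  the boundary at infinity.\<close>

lemma hyperbolic_space_superlevel_compact:
  fixes c a \<epsilon> :: real
  assumes "0 < \<epsilon>" "0 < a" "0 < c"
  shows "compact {y :: real^'n::{finite,linorder}. c \<le> last_coord y \<and>
    a * last_coord y \<le> 1 - \<epsilon> * (norm y)\<^sup>2}" (is "compact ?K")
proof -
  have "closed ?K"
    unfolding last_coord_def by (intro closed_Collect_conj closed_Collect_le continuous_intros)
  \<comment> \<open>A cruder bound than the square root of \<open>1 / \<epsilon>\<close>; its square
    visibly dominates \<open>1 / \<epsilon>\<close>.\<close>
  moreover have "norm y \<le> 1 + 1 / \<epsilon>" if y: "y \<in> ?K" for y
  proof -
    have "0 < a * last_coord y"
      using y assms by auto
    then have "\<epsilon> * (norm y)\<^sup>2 \<le> 1"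
      using y by auto
    then have "(norm y)\<^sup>2 \<le> 1 / \<epsilon>"
      using assms(1) by (simp add: field_simps)
    also have "\<dots> \<le> 1 + 2 * (1 / \<epsilon>) + (1 / \<epsilon>)\<^sup>2"
      using zero_le_power2[of "1 / \<epsilon>"] divide_pos_pos[OF zero_less_one assms(1)] by linarith
    also have "\<dots> = (1 + 1 / \<epsilon>)\<^sup>2"
      by (simp add: power2_sum)
    finally show ?thesis
      using assms(1) by (simp add: power2_le_iff_abs_le)
  qed
  then have "bounded ?K"
    unfolding bounded_iff by blast
  ultimately show ?thesis
    by (simp add: compact_eq_bounded_closed)
qed

section \<open>From local constancy in charts to the whole manifold\<close>

theorem theorem3p7:
  fixes M :: "'a topology"
    and A :: "('a, 'm::finite) chart set"
    and g :: "('a, 'm) metric_components"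
    and f :: "'a \<Rightarrow> real^'n::{finite,linorder}"
    and c :: real
  assumes "c > 0"
    and "complete_riemannian_manifold M A g"
    and "connected_space M"
    and "harmonic_map M A g hyperbolic_space hyperbolic_metric f"
    and "proper_into M hyperbolic_space f"
    and "f ` topspace M \<subseteq> {x \<in> hyperbolic_space. last_coord x > c}"
  shows "f constant_on topspace M"
proof (cases "topspace M = {}")
  case True
  then show ?thesis
    by (simp add: constant_on_def)
next
  case False
  then obtain p0 where p0: "p0 \<in> topspace M"
    by blast
  have riem: "riemannian_manifold M A g" and mfd: "smooth_manifold M A"
    using assms(2) by (auto simp: complete_riemannian_manifold_def riemannian_manifold_def)
  have chart: "\<exists>U \<phi>. (U, \<phi>) \<in> A \<and> p \<in> U" if "p \<in> topspace M" for p
  proof -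
    have "p \<in> (\<Union>C\<in>A. fst C)"
      using mfd that by (simp add: smooth_manifold_def)
    then show ?thesis
      by force
  qed
  have chart_facts: "openin M U" "open (\<phi> ` U)" "inj_on \<phi> U" "continuous_map (subtopology M U) euclidean \<phi>"
    "smooth_on (\<phi> ` U) (f \<circ> inv_into U \<phi>)" "riemannian_metric_on (\<phi> ` U) (g (U, \<phi>))"
    "\<And>x. x \<in> \<phi> ` U \<Longrightarrow> tension_field (g (U, \<phi>)) hyperbolic_metric (f \<circ> inv_into U \<phi>) x = 0"
    if C: "(U, \<phi>) \<in> A" for U \<phi>
  proof -
    have "is_chart M (U, \<phi>)"
      using mfd C by (auto simp: smooth_manifold_def)
    then have chart: "openin M U" "open (\<phi> ` U)"
      "homeomorphic_map (subtopology M U) (top_of_set (\<phi> ` U)) \<phi>"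
      by (auto simp: is_chart_def)
    then show "openin M U" "open (\<phi> ` U)"
      by auto
    have "topspace (subtopology M U) = U"
      using openin_subset[OF chart(1)] by auto
    then show "inj_on \<phi> U"
      using homeomorphic_imp_injective_map[OF chart(3)] by simp
    show "continuous_map (subtopology M U) euclidean \<phi>"
      using homeomorphic_imp_continuous_map[OF chart(3)] by (simp add: continuous_map_in_subtopology)
    show "riemannian_metric_on (\<phi> ` U) (g (U, \<phi>))"
      using riem C by (auto simp: riemannian_manifold_def)
    show "smooth_on (\<phi> ` U) (f \<circ> inv_into U \<phi>)"
      "\<And>x. x \<in> \<phi> ` U \<Longrightarrow> tension_field (g (U, \<phi>)) hyperbolic_metric (f \<circ> inv_into U \<phi>) x = 0"
      using assms(4) C by (auto simp: harmonic_map_def)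
  qed
  \<comment> \<open>Pulls neighbourhoods in coordinates back to open sets of \<open>M\<close>, to
    transfer local conclusions to the manifold.\<close>
  have chart_ball: "\<exists>T. openin M T \<and> p \<in> T \<and> T \<subseteq> U \<and> \<phi> ` T \<subseteq> W"
    if C: "(U, \<phi>) \<in> A" and p: "p \<in> U" and W: "open W" "\<phi> p \<in> W" for U \<phi> p W
  proof -
    have "openin (subtopology M U) {q \<in> topspace (subtopology M U). \<phi> q \<in> W}"
      using chart_facts(4)[OF C] W(1) by (intro openin_continuous_map_preimage) auto
    then have "openin M {q \<in> topspace (subtopology M U). \<phi> q \<in> W}"
      using chart_facts(1)[OF C] openin_trans_full by blast
    then show ?thesis
      using p W(2) openin_subset[OF chart_facts(1)[OF C]]
      by (intro exI[of _ "{q \<in> topspace (subtopology M U). \<phi> q \<in> W}"]) auto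
  qed
  \<comment> \<open>Harmonicity gives smoothness in charts; continuity on \<open>M\<close> is glued
    together from it.\<close>
  have f_cont: "continuous_map M euclidean f"
    unfolding continuous_map_def
  proof (intro conjI allI impI)
    fix W :: "(real^'n::{finite,linorder}) set" assume "openin euclidean W"
    then have W: "open W"
      by simp
    show "openin M {p \<in> topspace M. f p \<in> W}"
    proof (subst openin_subopen, safe)
      fix p assume p: "p \<in> topspace M" "f p \<in> W"
      obtain U \<phi> where C: "(U, \<phi>) \<in> A" "p \<in> U"
        using chart[OF p(1)] by blast
      let ?F = "f \<circ> inv_into U \<phi>"
      note cf = chart_facts[OF C(1)]
      have F: "?F (\<phi> q) = f q" if "q \<in> U" for q
        using cf(3) that by simp
      have "continuous_on (\<phi> ` U) ?F"
        by (rule smooth_on_imp_continuous_on[OF cf(5)])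
      then have "open (?F -` W \<inter> \<phi> ` U)"
        using continuous_on_open_vimage cf(2) W by blast
      then obtain T where T: "openin M T" "p \<in> T" "T \<subseteq> U" "\<phi> ` T \<subseteq> ?F -` W \<inter> \<phi> ` U"
        using chart_ball[OF C, of "?F -` W \<inter> \<phi> ` U"] F[OF C(2)] p C by auto
      have "T \<subseteq> {p \<in> topspace M. f p \<in> W}"
        using T F openin_subset[OF T(1)] by force
      then show "\<exists>T. openin M T \<and> p \<in> T \<and> T \<subseteq> {p \<in> topspace M. f p \<in> W}"
        using T by blast
    qed
  qed auto
  have above: "c < last_coord (f p)" if "p \<in> topspace M" for p
    using assms(6) that by auto
  \<comment> \<open>This makes \<open>\<epsilon> * (norm (f p0))\<^sup>2\<close> less than 1/2, so
    \<open>w\<close> is positive at \<open>f p0\<close>; adding 1 covers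
    \<open>f p0 = 0\<close>.\<close>
  define \<epsilon> where "\<epsilon> = 1 / (2 * ((norm (f p0))\<^sup>2 + 1))"
  have "0 < \<epsilon>"
    by (simp add: \<epsilon>_def add_nonneg_pos)
  have "\<epsilon> * (norm (f p0))\<^sup>2 < 1"
  proof -
    have "s < 2 * (s + 1)" "0 < 2 * (s + 1)" if "0 \<le> s" for s :: real
      using that by auto
    then show ?thesis
      unfolding \<epsilon>_def by (simp only: times_divide_eq_left mult_1 divide_less_eq_1_pos zero_le_power2)
  qed
  define w where "w y = (1 - \<epsilon> * (norm y)\<^sup>2) / last_coord y" for y :: "real^'n::{finite,linorder}"
  have "0 < w (f p0)"
    using \<open>\<epsilon> * (norm (f p0))\<^sup>2 < 1\<close> above[OF p0] \<open>c > 0\<close> by (simp add: w_def)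
  \<comment> \<open>The superlevel set of \<open>w\<close> at the value \<open>w (f p0)\<close>, cut
    off at the horosphere and cleared of the denominator.\<close>
  define K where "K = {y :: real^'n::{finite,linorder}. c \<le> last_coord y \<and> w (f p0) * last_coord y \<le> 1 - \<epsilon> * (norm y)\<^sup>2}"
  have K_pos: "0 < last_coord y" if "y \<in> K" for y
    using that \<open>c > 0\<close> by (simp add: K_def)
  have in_K: "f p \<in> K \<longleftrightarrow> w (f p0) \<le> w (f p)" if "p \<in> topspace M" for p
    using above[OF that] \<open>c > 0\<close> by (simp add: K_def w_def pos_le_divide_eq)
  have "compact K"
    unfolding K_def
    using hyperbolic_space_superlevel_compact \<open>0 < \<epsilon>\<close> \<open>0 < w (f p0)\<close> \<open>c > 0\<close> by blast
  moreover have "K \<subseteq> hyperbolic_space"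
    using K_pos by (auto simp: hyperbolic_space_def)
  ultimately have "compactin M {p \<in> topspace M. f p \<in> K}"
    using assms(5) by (auto simp: proper_into_def)
  then have "compact (f ` {p \<in> topspace M. f p \<in> K})"
    using image_compactin[OF _ f_cont] by simp
  moreover have "p0 \<in> {p \<in> topspace M. f p \<in> K}"
    using p0 in_K by simp
  moreover have "continuous_on (f ` {p \<in> topspace M. f p \<in> K}) w"
    unfolding w_def last_coord_def
    by (intro continuous_intros)
      (auto simp: less_imp_neq[OF K_pos, unfolded last_coord_def, THEN not_sym])
  ultimately obtain p1 where p1: "p1 \<in> topspace M" "f p1 \<in> K"
    and w_max: "\<And>p. p \<in> topspace M \<Longrightarrow> f p \<in> K \<Longrightarrow> w (f p) \<le> w (f p1)"
    using continuous_attains_sup[of "f ` {p \<in> topspace M. f p \<in> K}" w] by auto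
  \<comment> \<open>The maximum over the preimage of \<open>K\<close> is global, since outside it
    \<open>w (f p)\<close> lies below \<open>w (f p0)\<close>.\<close>
  have w_le: "w (f p) \<le> w (f p1)" if "p \<in> topspace M" for p
    using w_max[OF that] in_K[OF that] in_K[OF p1(1)] p1(2) by linarith
  have "0 < w (f p1)"
    using \<open>0 < w (f p0)\<close> w_le[OF p0] by linarith
  let ?Z = "{p \<in> topspace M. f p = f p1}"
  \<comment> \<open>Each point of \<open>?Z\<close> is again a maximum point of \<open>w\<close>
    composed with \<open>f\<close>, so local constancy applies in a chart around it.\<close>
  have "openin M ?Z"
  proof (subst openin_subopen, safe)
    fix p assume p: "p \<in> topspace M" "f p = f p1"
    obtain U \<phi> where C: "(U, \<phi>) \<in> A" "p \<in> U"
      using chart[OF p(1)] by blast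
    note cf = chart_facts[OF C(1)]
    let ?F = "f \<circ> inv_into U \<phi>"
    have F: "?F (\<phi> q) = f q" if "q \<in> U" for q
      using cf(3) that by simp
    have U: "U \<subseteq> topspace M"
      by (rule openin_subset[OF cf(1)])
    obtain r where r: "0 < r" "ball (\<phi> p) r \<subseteq> \<phi> ` U" "\<And>x. x \<in> ball (\<phi> p) r \<Longrightarrow> ?F x = ?F (\<phi> p)"
    proof (rule hyperbolic_harmonic_locally_constant[OF cf(2) imageI[OF C(2)] cf(6,5,7)])
      show "0 < last_coord (?F x)" if "x \<in> \<phi> ` U" for x
        using that above U F \<open>c > 0\<close> by fastforce
      show "1 - \<epsilon> * (norm (?F x))\<^sup>2 \<le> w (f p1) * last_coord (?F x)" if "x \<in> \<phi> ` U" for x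
      proof -
        from that obtain q where q: "q \<in> U" "x = \<phi> q"
          by blast
        have "q \<in> topspace M"
          using q(1) U by blast
        then have "w (f q) \<le> w (f p1)" "0 < last_coord (f q)"
          using w_le above \<open>c > 0\<close> by (blast, force)
        then show ?thesis
          unfolding q(2) F[OF q(1)] by (simp add: w_def[of "f q"] pos_divide_le_eq)
      qed
      show "1 - \<epsilon> * (norm (?F (\<phi> p)))\<^sup>2 = w (f p1) * last_coord (?F (\<phi> p))"
        unfolding F[OF C(2)] p(2) using K_pos[OF p1(2)] by (simp add: w_def)
    qed (assumption | rule \<open>0 < w (f p1)\<close> | (rule that; blast))+
    obtain T where T: "openin M T" "p \<in> T" "T \<subseteq> U" "\<phi> ` T \<subseteq> ball (\<phi> p) r"
      using chart_ball[OF C open_ball centre_in_ball[THEN iffD2, OF r(1)]] by blast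
    have "f q = f p1" if "q \<in> T" for q
      using r(3)[of "\<phi> q"] T that F[OF C(2)] F[of q] p(2) by (metis image_subset_iff subsetD)
    then show "\<exists>T. openin M T \<and> p \<in> T \<and> T \<subseteq> ?Z"
      using T U by blast
  qed
  moreover have "closedin M ?Z"
    using closedin_continuous_map_preimage[OF f_cont, of "{f p1}"] by simp
  ultimately have "?Z = topspace M"
    using assms(3) p1(1) unfolding connected_space_clopen_in by blast
  then show ?thesis
    by (auto simp: constant_on_def)
qed

end
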